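(* Let $x\in\mathbb{R}\setminus\{0\}$, and let $k\in(0,1)$ be the unique number with $|x|=\dfrac{K(k')}{K(k)}$, where $k'=\sqrt{1-k^2}$. Then $$S_2(ix)=\frac43\,\operatorname{sign}(x)\,K(k')\left[3E(k)+(k^2-2)K(k)\right],$$ $$S_2\left(\frac{\pm1+ix}{2}\right)=2\,\operatorname{sign}(x)\,K(k')\left[2E(k)+\frac{4k^2-5}{3}K(k)\right],$$ the second formula holding for each choice of the sign $\pm$.
   Context: For $\tau\in\mathbb{C}$ with $\operatorname{Im}\tau\neq0$ define the (conditionally convergent) lattice sum $$S_2(\tau)=\operatorname{Im}\tau\ \sum^{e}_{(m,n)\in\mathbb{Z}^2\setminus\{(0,0)\}}\frac{1}{(m+n\tau)^2},$$ where $\sum^{e}$ denotes Eisenstein summation, $$\sum^{e}_{m,n}:=\lim_{M_2\to\infty}\sum_{n=-M_2}^{M_2}\left(\lim_{M_1\to\infty}\sum_{m=-M_1}^{M_1}\right),$$ the term $(m,n)=(0,0)$ being omitted. The complete elliptic integrals of the first and second kind with modulus $k\in(0,1)$ are $$K(k)=\int_0^1\frac{dt}{\sqrt{(1-t^2)(1-k^2t^2)}},\qquad E(k)=\int_0^1\sqrt{\frac{1-k^2t^2}{1-t^2}}\,dt.$$ The map $k\mapsto K(k')/K(k)$, with $k'=\sqrt{1-k^2}$, is a decreasing bijection from $(0,1)$ onto $(0,\infty)$. *)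

theory Defs
  imports "HOL-Analysis.Analysis"
begin

definition row_sum :: "(int \<Rightarrow> int \<Rightarrow> complex) \<Rightarrow> int \<Rightarrow> nat \<Rightarrow> complex" where
  "row_sum f n M = (\<Sum>m = - int M..int M. f m n)"

definition eisenstein_partial :: "(int \<Rightarrow> int \<Rightarrow> complex) \<Rightarrow> nat \<Rightarrow> complex" where
  "eisenstein_partial f M = (\<Sum>n = - int M..int M. lim (row_sum f n))"

definition eisenstein_sum :: "(int \<Rightarrow> int \<Rightarrow> complex) \<Rightarrow> complex" where
  "eisenstein_sum f = lim (eisenstein_partial f)"

text \<open>Since \<^const>\<open>lim\<close> is total, the existence of the iterated limits is recorded separately.\<close>

definition eisenstein_summable :: "(int \<Rightarrow> int \<Rightarrow> complex) \<Rightarrow> bool" where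
  "eisenstein_summable f \<longleftrightarrow>
     (\<forall>n. convergent (row_sum f n)) \<and> convergent (eisenstein_partial f)"

definition S2_term :: "complex \<Rightarrow> int \<Rightarrow> int \<Rightarrow> complex" where
  "S2_term \<tau> m n = (if (m, n) = (0, 0) then 0 else 1 / (of_int m + of_int n * \<tau>)\<^sup>2)"

definition S2 :: "complex \<Rightarrow> complex" where
  "S2 \<tau> = of_real (Im \<tau>) * eisenstein_sum (S2_term \<tau>)"

text \<open>The integrands are singular at \<open>t = 1\<close>; division by zero gives them the value 0 there,
  which does not affect the integral.\<close>

definition elliptic_K :: "real \<Rightarrow> real" where
  "elliptic_K k = integral {0..1} (\<lambda>t. 1 / sqrt ((1 - t\<^sup>2) * (1 - k\<^sup>2 * t\<^sup>2)))"

definition elliptic_E :: "real \<Rightarrow> real" where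
  "elliptic_E k = integral {0..1} (\<lambda>t. sqrt ((1 - k\<^sup>2 * t\<^sup>2) / (1 - t\<^sup>2)))"

end

theory Submission
  imports Defs "HOL-Complex_Analysis.Complex_Analysis" "HOL-Real_Asymp.Real_Asymp"
begin

text \<open>Put \<open>p = \<pi> \<bar>x\<bar>\<close>, \<open>N u = \<Sum>n. 1 / sin (u + \<i> n p)\<close> and \<open>P u = \<Sum>n. 1 / sin (u + \<i> n p)\<^sup>2\<close>. Summing
  the rows by \<open>\<Sum>m. 1 / (m + z)\<^sup>2 = \<pi>\<^sup>2 / sin (\<pi> z)\<^sup>2\<close> expresses both Eisenstein sums through the constant
  term of \<open>P\<close> at 0 and the value of \<open>P\<close> at \<open>\<pi> / 2 + \<i> p / 2\<close>. By Liouville's theorem \<open>N\<^sup>2 - P\<close> is a constant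
  \<open>a\<close> and \<open>N'' = 2 N\<^sup>3 + c N\<close>, where \<open>a\<close> and \<open>c\<close> are read off at 0. On the line through \<open>\<i> p / 2\<close> the
  energy integral is \<open>N'\<^sup>2 = (A\<^sup>2 - N\<^sup>2) (B\<^sup>2 - N\<^sup>2)\<close> with \<open>0 < B < A\<close>; integrating over a quarter period
  there and along the imaginary axis gives \<open>K(k) = A \<pi> / 2\<close> and \<open>K(k') = A p / 2\<close> for \<open>k = B / A\<close>, hence
  \<open>K(k') / K(k) = \<bar>x\<bar>\<close>, which determines \<open>k\<close>. As \<open>P\<close> has mean 0 on horizontal lines, integrating \<open>N\<^sup>2\<close>
  over the same quarter period gives \<open>a\<close> in terms of \<open>E(k)\<close>.\<close>

section \<open>Summation over rows\<close>

text \<open>Away from \<open>n = 0\<close> the row sums decay exponentially, so \<open>P\<close> is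
  an unconditional sum over rows. The order of summation survives only in its additive constant:
  every row has mean 0 over a period, which fixes the constant by which \<open>P\<close> differs
  from the Weierstrass function. This normalization is what brings in \<open>E\<close>; the
  differential equation by itself yields only values of \<open>K\<close>. \<open>N\<close> is used
  besides \<open>P\<close> because it is a single-valued square root of \<open>P + a\<close>, and
  its energy integral is already in Legendre form, so its restrictions to two lines invert elliptic
  integrals directly. Both \<open>a\<close> and \<open>c\<close> contain the unknown derivative at 0
  of \<open>N - 1 / sin\<close>. Eliminating it expresses the constant term of \<open>P\<close>
  through \<open>a\<close> and \<open>c\<close>, hence through \<open>A\<close>, \<open>B\<close>
  and the mean of \<open>N^2\<close>.\<close>

lemma Polygamma_1_reflection:
  fixes z :: complex
  assumes "Im z \<noteq> 0"
  shows "Polygamma 1 z + Polygamma 1 (1 - z) = of_real pi ^ 2 / sin (of_real pi * z) ^ 2"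
proof -
  define U where "U = {z :: complex. Im z \<noteq> 0}"
  have U: "open U"
    unfolding U_def by (intro open_Collect_neq continuous_intros)
  have nonint: "z \<notin> \<int>\<^sub>\<le>\<^sub>0" "1 - z \<notin> \<int>\<^sub>\<le>\<^sub>0" if "z \<in> U" for z
    using that by (auto simp: U_def elim!: nonpos_Ints_cases' simp: complex_eq_iff)
  have sin_nz: "sin (of_real pi * z) \<noteq> 0" if "z \<in> U" for z
  proof
    assume "sin (of_real pi * z) = 0"
    then obtain n :: int where "of_real pi * z = of_real (of_int n * pi)"
      by (auto simp: sin_eq_0)
    then have "Im (of_real pi * z) = 0" by (metis Im_complex_of_real)
    with that show False by (simp add: U_def)
  qed
  have refl: "Gamma z * Gamma (1 - z) = of_real pi / sin (of_real pi * z)" for z :: complex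
    by (rule Gamma_reflection_complex)
  \<comment> \<open>The logarithmic derivative of the reflection formula for Gamma; the common
    factor \<open>pi / sin (pi z)\<close> is nonzero and cancels. A second differentiation gives the
    claim, the inner \<open>1 - z\<close> turning the difference into a sum.\<close>
  have psi: "Digamma z - Digamma (1 - z) = - of_real pi * cos (of_real pi * z) / sin (of_real pi * z)"
    if z: "z \<in> U" for z
  proof -
    note [simp] = nonint[OF z] sin_nz[OF z]
    have "((\<lambda>z. Gamma z * Gamma (1 - z)) has_field_derivative
            Gamma z * Gamma (1 - z) * (Digamma z - Digamma (1 - z))) (at z)"
      by (auto intro!: derivative_eq_intros simp: algebra_simps)
    moreover have "((\<lambda>z. of_real pi / sin (of_real pi * z)) has_field_derivative
            - of_real pi * (of_real pi * cos (of_real pi * z)) / sin (of_real pi * z) ^ 2) (at z)"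
      by (auto intro!: derivative_eq_intros simp: power2_eq_square)
    ultimately have "Gamma z * Gamma (1 - z) * (Digamma z - Digamma (1 - z)) =
       - of_real pi * (of_real pi * cos (of_real pi * z)) / sin (of_real pi * z) ^ 2"
      unfolding refl by (rule DERIV_unique)
    then have "of_real pi / sin (of_real pi * z) * (Digamma z - Digamma (1 - z)) =
       of_real pi / sin (of_real pi * z) * (- of_real pi * cos (of_real pi * z) / sin (of_real pi * z))"
      unfolding refl by (simp add: power2_eq_square)
    then show ?thesis
      by (subst (asm) mult_cancel_left) auto
  qed
  have z: "z \<in> U" using assms by (simp add: U_def)
  note [simp] = nonint[OF z] sin_nz[OF z]
  have "((\<lambda>z. Digamma z - Digamma (1 - z)) has_field_derivative
           Polygamma 1 z + Polygamma 1 (1 - z)) (at z)"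
    by (auto intro!: derivative_eq_intros)
  moreover have "((\<lambda>z. - of_real pi * cos (of_real pi * z) / sin (of_real pi * z)) has_field_derivative
       of_real pi ^ 2 / sin (of_real pi * z) ^ 2) (at z)"
  proof -
    let ?P = "complex_of_real pi" and ?S = "sin (of_real pi * z)" and ?C = "cos (of_real pi * z)"
    have "?P * (?P * (?S * ?S)) + ?P * (?P * (?C * ?C)) = ?P * ?P"
      using sin_cos_squared_add3[of "of_real pi * z"] by algebra
    moreover have "((\<lambda>z. - of_real pi * cos (of_real pi * z) / sin (of_real pi * z)) has_field_derivative
        (?P * (?P * (?S * ?S)) + ?P * (?P * (?C * ?C))) / (?S * ?S)) (at z)"
      by (rule derivative_eq_intros refl | simp add: minus_divide_left)+
    ultimately show ?thesis by (simp add: power2_eq_square)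
  qed
  then have "((\<lambda>z. Digamma z - Digamma (1 - z)) has_field_derivative
       of_real pi ^ 2 / sin (of_real pi * z) ^ 2) (at z)"
    by (rule has_field_derivative_transform_within_open[OF _ U z]) (simp add: psi)
  ultimately show ?thesis
    by (auto dest: DERIV_unique)
qed

lemma sum_symmetric_int:
  fixes f :: "int \<Rightarrow> 'a :: ab_group_add"
  shows "(\<Sum>m = - int M..int M. f m) = (\<Sum>k<Suc M. f (int k)) + (\<Sum>k<M. f (- int (Suc k)))"
proof (induction M)
  case (Suc M)
  have "{- int (Suc M)..int (Suc M)} = insert (int (Suc M)) (insert (- int (Suc M)) {- int M..int M})"
    by auto
  then show ?case
    by (simp add: Suc algebra_simps)
qed auto

text \<open>The terms with \<open>m \<ge> 0\<close> form the trigamma series at \<open>z\<close>.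
  Those with \<open>m = - (k + 1)\<close> form the series at \<open>1 - z\<close>, because squaring
  removes the sign.\<close>

lemma row_sum_nonreal:
  assumes "Im z \<noteq> 0"
  shows "(\<lambda>M. \<Sum>m = - int M..int M. 1 / (of_int m + z) ^ 2)
           \<longlonglongrightarrow> of_real pi ^ 2 / sin (of_real pi * z) ^ 2"
proof -
  have nz: "z \<noteq> 0" "1 - z \<noteq> 0"
    using assms by (auto simp: complex_eq_iff)
  have 1: "(\<lambda>k. inverse ((z + of_nat k) ^ 2)) sums Polygamma 1 z"
    using Polygamma_LIMSEQ[OF nz(1), of 1] by (simp add: numeral_2_eq_2)
  have 2: "(\<lambda>k. inverse ((1 - z + of_nat k) ^ 2)) sums Polygamma 1 (1 - z)"
    using Polygamma_LIMSEQ[OF nz(2), of 1] by (simp add: numeral_2_eq_2)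
  have "(\<lambda>M. (\<Sum>k<Suc M. inverse ((z + of_nat k) ^ 2)) + (\<Sum>k<M. inverse ((1 - z + of_nat k) ^ 2)))
          \<longlonglongrightarrow> Polygamma 1 z + Polygamma 1 (1 - z)"
    using 1 2 unfolding sums_def by (intro tendsto_add filterlim_compose[OF _ filterlim_Suc])
  moreover have "(1 - z + of_nat k) ^ 2 = (of_int (- int (Suc k)) + z) ^ 2" for k
    by (simp add: power2_eq_square algebra_simps)
  ultimately show ?thesis
    by (simp add: sum_symmetric_int Polygamma_1_reflection[OF assms, unfolded One_nat_def]
          inverse_eq_divide add.commute del: of_nat_Suc of_int_minus)
qed

lemma row_sum_zero:
  "(\<lambda>M. \<Sum>m = - int M..int M. if m = 0 then 0 else 1 / (of_int m :: complex) ^ 2)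
     \<longlonglongrightarrow> of_real pi ^ 2 / 3"
proof -
  have "(\<lambda>n. 1 / (of_nat n + 1)\<^sup>2 :: complex) sums of_real (pi\<^sup>2 / 6)"
    using sums_of_real[OF inverse_squares_sums, where 'a = complex] by (simp add: add.commute)
  then have L: "(\<lambda>M. \<Sum>k<M. 1 / (of_nat k + 1)\<^sup>2 :: complex) \<longlonglongrightarrow> of_real pi ^ 2 / 6"
    by (simp add: sums_def)
  have eq: "(\<Sum>m = - int M..int M. if m = 0 then 0 else 1 / (of_int m :: complex) ^ 2)
     = 2 * (\<Sum>k<M. 1 / (of_nat k + 1)\<^sup>2)" for M
    unfolding sum_symmetric_int sum.lessThan_Suc_shift
    by (simp add: add.commute power2_commute[of "- 1"] power2_eq_square algebra_simps)
  show ?thesis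
    unfolding eq using tendsto_mult[OF tendsto_const[of 2] L] by simp
qed

lemma summable_on_int_geometric:
  fixes q :: real
  assumes "0 \<le> q" "q < 1"
  shows "(\<lambda>n::int. q ^ nat \<bar>n\<bar>) summable_on A"
proof -
  have s: "(\<lambda>n. q ^ n) summable_on (UNIV :: nat set)"
    using assms summable_geometric[of q] by (intro norm_summable_imp_summable_on) auto
  have 1: "(\<lambda>n::int. q ^ nat \<bar>n\<bar>) summable_on (int ` UNIV)"
    using s by (subst summable_on_reindex) (auto simp: o_def)
  have 2: "(\<lambda>n::int. q ^ nat \<bar>n\<bar>) summable_on ((\<lambda>n. - int n) ` UNIV)"
    using s by (subst summable_on_reindex) (auto simp: o_def inj_on_def)
  have "(\<lambda>n::int. q ^ nat \<bar>n\<bar>) summable_on (int ` UNIV \<union> (\<lambda>n. - int n) ` UNIV)"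
    by (rule summable_on_union[OF 1 2])
  then show ?thesis
  proof (rule summable_on_subset_banach)
    show "A \<subseteq> range int \<union> range (\<lambda>n. - int n)"
      using int_cases2 by blast
  qed
qed

text \<open>With \<open>y\<close> the absolute imaginary part, \<open>sin u\<close> has norm at
  least \<open>(exp y - exp (- y)) / 2\<close>. The cutoff 1 ensures that the smaller exponential
  costs at most half of the larger one; it reappears as the margin in
  \<open>near_rows\<close>.\<close>

lemma norm_inverse_sin_le:
  fixes u :: complex
  assumes "\<bar>Im u\<bar> \<ge> 1"
  shows "norm (1 / sin u) \<le> 4 * exp (- \<bar>Im u\<bar>)" and "sin u \<noteq> 0"
proof -
  define y where "y = \<bar>Im u\<bar>"
  have y: "y \<ge> 1" using assms by (simp add: y_def)
  have 1: "norm (sin u) = norm (exp (\<i> * u) - exp (- (\<i> * u))) / 2"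
    by (simp add: sin_exp_eq norm_divide norm_mult)
  have 2: "\<bar>exp (- Im u) - exp (Im u)\<bar> \<le> norm (exp (\<i> * u) - exp (- (\<i> * u)))"
    using norm_triangle_ineq3[of "exp (\<i> * u)" "exp (- (\<i> * u))"] by simp
  have 3: "\<bar>exp (- Im u) - exp (Im u)\<bar> = exp y - exp (- y)"
    by (cases "Im u \<ge> 0") (auto simp: y_def)
  have 4: "exp y / 2 \<le> exp y - exp (- y)"
  proof -
    have "exp 1 \<le> exp y" using y by simp
    moreover have "2 \<le> exp (1::real)" using exp_ge_add_one_self[of 1] by simp
    ultimately have "2 \<le> exp y" by linarith
    then have "2 * 1 \<le> exp y * exp y" using y by (intro mult_mono) auto
    then show ?thesis using y by (simp add: exp_minus field_simps)
  qed
  have le: "exp y / 4 \<le> norm (sin u)" using 1 2 3 4 by linarith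
  then show nz: "sin u \<noteq> 0" using exp_gt_zero[of y] by force
  have "norm (1 / sin u) = 1 / norm (sin u)" by (simp add: norm_divide)
  also have "\<dots> \<le> 1 / (exp y / 4)"
    using le by (intro divide_left_mono) (auto simp: nz)
  finally show "norm (1 / sin u) \<le> 4 * exp (- \<bar>Im u\<bar>)"
    by (simp add: y_def exp_minus field_simps)
qed

section \<open>Sums of powers of the cosecant\<close>

text \<open>Since \<open>1 / 0 = 0\<close>, a singular term drops out: for \<open>p > 0\<close> the
  value \<open>csc_sum 2 p 0\<close> is already the sum over \<open>n \<noteq> 0\<close>.\<close>

definition csc_sum :: "nat \<Rightarrow> real \<Rightarrow> complex \<Rightarrow> complex" where
  "csc_sum j p u = (\<Sum>\<^sub>\<infinity>n::int. 1 / sin (u + \<i> * of_real (of_int n * p)) ^ j)"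

definition csc_lattice :: "real \<Rightarrow> complex set" where
  "csc_lattice p = {u. \<exists>n::int. sin (u + \<i> * of_real (of_int n * p)) = 0}"

text \<open>On the strip where the imaginary part is at most \<open>R\<close> in absolute value,
  every other row has imaginary part at least 1 in absolute value. Those rows have no pole in the
  strip and share a geometric majorant; the rows kept here are finitely many.\<close>

definition near_rows :: "real \<Rightarrow> real \<Rightarrow> int set" where
  "near_rows p R = {n. \<bar>of_int n\<bar> * p < R + 1}"

lemma finite_near_rows:
  assumes "p > 0"
  shows "finite (near_rows p R)"
proof (rule finite_subset)
  show "near_rows p R \<subseteq> {- \<lceil>(R + 1) / p\<rceil>..\<lceil>(R + 1) / p\<rceil>}"
  proof
    fix n :: int assume "n \<in> near_rows p R"
    then have "\<bar>of_int n\<bar> < (R + 1) / p"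
      using assms by (simp add: near_rows_def field_simps)
    then have "real_of_int \<bar>n\<bar> \<le> of_int \<lceil>(R + 1) / p\<rceil>"
      using le_of_int_ceiling[of "(R + 1) / p"] by linarith
    then have "\<bar>n\<bar> \<le> \<lceil>(R + 1) / p\<rceil>"
      by linarith
    then show "n \<in> {- \<lceil>(R + 1) / p\<rceil>..\<lceil>(R + 1) / p\<rceil>}" by auto
  qed
qed auto

lemma far_row_bounds:
  fixes n :: int
  assumes "p > 0" "\<bar>Im u\<bar> \<le> R" "n \<notin> near_rows p R"
  shows "sin (u + \<i> * of_real (of_int n * p)) \<noteq> 0"
    and "norm (1 / sin (u + \<i> * of_real (of_int n * p)) ^ j) \<le>
           (4 * exp R) ^ j * (exp (- (real j * p))) ^ nat \<bar>n\<bar>"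
proof -
  let ?v = "u + \<i> * of_real (of_int n * p)"
  have "\<bar>Im ?v\<bar> \<ge> \<bar>of_int n * p\<bar> - \<bar>Im u\<bar>"
    by simp
  then have ge: "\<bar>Im ?v\<bar> \<ge> \<bar>of_int n\<bar> * p - R"
    using assms by (simp add: abs_mult)
  moreover have "R + 1 \<le> \<bar>of_int n\<bar> * p"
    using assms by (simp add: near_rows_def)
  ultimately have 1: "\<bar>Im ?v\<bar> \<ge> 1" by linarith
  show "sin ?v \<noteq> 0" by (rule norm_inverse_sin_le[OF 1])
  have "norm (1 / sin ?v) \<le> 4 * exp (- \<bar>Im ?v\<bar>)"
    by (rule norm_inverse_sin_le[OF 1])
  also have "\<dots> \<le> 4 * exp (R - \<bar>of_int n\<bar> * p)"
    using ge by simp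
  finally have "norm (1 / sin ?v) ^ j \<le> (4 * exp (R - \<bar>of_int n\<bar> * p)) ^ j"
    by (intro power_mono) auto
  also have "\<dots> = (4 * exp R) ^ j * exp (- (\<bar>of_int n\<bar> * p)) ^ j"
    by (simp add: exp_diff exp_minus field_simps)
  also have "exp (- (\<bar>of_int n\<bar> * p)) ^ j = (exp (- (real j * p))) ^ nat \<bar>n\<bar>"
    by (simp flip: exp_of_nat_mult add: algebra_simps)
  finally show "norm (1 / sin ?v ^ j) \<le> (4 * exp R) ^ j * (exp (- (real j * p))) ^ nat \<bar>n\<bar>"
    by (simp add: norm_divide norm_power power_divide)
qed

lemma summable_far_majorant:
  fixes A :: "int set"
  assumes "p > 0" "j > 0"
  shows "(\<lambda>n. (4 * exp R) ^ j * (exp (- (real j * p))) ^ nat \<bar>n\<bar>) summable_on A"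
  using assms by (intro summable_on_cmult_right summable_on_int_geometric) auto

lemma uniform_limit_far_rows:
  assumes "p > 0" "j > 0"
  shows "uniform_limit {u. \<bar>Im u\<bar> \<le> R}
           (\<lambda>X u. \<Sum>n\<in>X. 1 / sin (u + \<i> * of_real (of_int n * p)) ^ j)
           (\<lambda>u. \<Sum>\<^sub>\<infinity>n\<in>- near_rows p R. 1 / sin (u + \<i> * of_real (of_int n * p)) ^ j)
           (finite_subsets_at_top (- near_rows p R))"
  by (rule Weierstrass_m_test_general[OF _ summable_far_majorant[OF assms]])
     (use far_row_bounds(2)[OF assms(1)] in auto)

lemma summable_csc:
  assumes "p > 0" "j > 0"
  shows "(\<lambda>n. 1 / sin (u + \<i> * of_real (of_int n * p)) ^ j) summable_on A"
proof -
  let ?f = "\<lambda>n. 1 / sin (u + \<i> * of_real (of_int n * p)) ^ j"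
  have "?f summable_on (- near_rows p \<bar>Im u\<bar>)"
    by (rule abs_summable_summable,
        rule Infinite_Sum.abs_summable_on_comparison_test'[OF summable_far_majorant[OF assms, of "\<bar>Im u\<bar>"]])
       (rule far_row_bounds(2)[OF assms(1)], auto)
  then have "?f summable_on (near_rows p \<bar>Im u\<bar> \<union> - near_rows p \<bar>Im u\<bar>)"
    using finite_near_rows[OF assms(1)] by (intro summable_on_Un_disjoint) auto
  then show ?thesis
    by (rule summable_on_subset_banach) auto
qed

lemma csc_sum_has_sum:
  assumes "p > 0" "j > 0"
  shows "((\<lambda>n. 1 / sin (u + \<i> * of_real (of_int n * p)) ^ j) has_sum csc_sum j p u) UNIV"
  unfolding csc_sum_def using summable_csc[OF assms] by simp

lemma csc_sum_split:
  assumes "p > 0" "j > 0"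
  shows "csc_sum j p u = (\<Sum>n\<in>near_rows p R. 1 / sin (u + \<i> * of_real (of_int n * p)) ^ j) +
           (\<Sum>\<^sub>\<infinity>n\<in>- near_rows p R. 1 / sin (u + \<i> * of_real (of_int n * p)) ^ j)"
proof -
  have "csc_sum j p u = (\<Sum>\<^sub>\<infinity>n\<in>near_rows p R \<union> - near_rows p R.
          1 / sin (u + \<i> * of_real (of_int n * p)) ^ j)"
    by (simp add: csc_sum_def)
  also have "\<dots> = (\<Sum>\<^sub>\<infinity>n\<in>near_rows p R. 1 / sin (u + \<i> * of_real (of_int n * p)) ^ j) +
           (\<Sum>\<^sub>\<infinity>n\<in>- near_rows p R. 1 / sin (u + \<i> * of_real (of_int n * p)) ^ j)"
    by (intro infsum_Un_disjoint summable_csc assms) auto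
  finally show ?thesis
    using finite_near_rows[OF assms(1)] by simp
qed

lemma holomorphic_far_rows:
  assumes "p > 0" "j > 0"
  shows "(\<lambda>u. \<Sum>\<^sub>\<infinity>n\<in>- near_rows p R. 1 / sin (u + \<i> * of_real (of_int n * p)) ^ j)
           holomorphic_on {u. \<bar>Im u\<bar> < R}" (is "?T holomorphic_on ?S")
proof -
  have S: "open ?S"
    by (intro open_Collect_less continuous_intros)
  show ?thesis
  proof (subst holomorphic_on_open[OF S], safe)
    fix z assume z: "\<bar>Im z\<bar> < R"
    then obtain r where r: "r > 0" "cball z r \<subseteq> ?S"
      using S open_contains_cball[of ?S] by auto
    have sub: "cball z r \<subseteq> {u. \<bar>Im u\<bar> \<le> R}" using r by force
    have hol: "(\<lambda>u. \<Sum>n\<in>X. 1 / sin (u + \<i> * of_real (of_int n * p)) ^ j) holomorphic_on cball z r"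
      if "X \<subseteq> - near_rows p R" for X
    proof (intro holomorphic_intros)
      fix n u assume "n \<in> X" "u \<in> cball z r"
      then show "sin (u + \<i> * of_real (of_int n * p)) ^ j \<noteq> 0"
        using far_row_bounds(1)[OF assms(1), of u R n] sub that by (auto simp: subset_eq)
    qed
    have ev: "\<forall>\<^sub>F X in finite_subsets_at_top (- near_rows p R).
       continuous_on (cball z r) (\<lambda>u. \<Sum>n\<in>X. 1 / sin (u + \<i> * of_real (of_int n * p)) ^ j) \<and>
       (\<lambda>u. \<Sum>n\<in>X. 1 / sin (u + \<i> * of_real (of_int n * p)) ^ j) holomorphic_on ball z r"
      using eventually_finite_subsets_at_top_weakI
    proof (rule eventually_mono)
      fix X assume "X \<subseteq> - near_rows p R"
      then show "continuous_on (cball z r) (\<lambda>u. \<Sum>n\<in>X. 1 / sin (u + \<i> * of_real (of_int n * p)) ^ j) \<and>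
       (\<lambda>u. \<Sum>n\<in>X. 1 / sin (u + \<i> * of_real (of_int n * p)) ^ j) holomorphic_on ball z r"
        using hol[of X] holomorphic_on_imp_continuous_on holomorphic_on_subset ball_subset_cball
        by blast
    qed auto
    have "?T holomorphic_on ball z r"
      by (rule holomorphic_uniform_limit[OF ev uniform_limit_on_subset[OF uniform_limit_far_rows[OF assms] sub]])
         auto
    then show "\<exists>f'. (?T has_field_derivative f') (at z)"
      using r(1) by (subst (asm) holomorphic_on_open) auto
  qed
qed

text \<open>Far rows have no zero in the strip, so the infinite intersection that defines the
  complement of the lattice becomes a finite one, which preserves openness.\<close>

lemma strip_minus_lattice_eq:
  assumes "p > 0"
  shows "{u. \<bar>Im u\<bar> < R} - csc_lattice p =
           {u. \<bar>Im u\<bar> < R} \<inter> (\<Inter>n\<in>near_rows p R. {u. sin (u + \<i> * of_real (of_int n * p)) \<noteq> 0})"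
proof -
  have "sin (u + \<i> * of_real (of_int n * p)) \<noteq> 0"
    if "\<bar>Im u\<bar> < R" "n \<notin> near_rows p R" for u n
    using far_row_bounds(1)[OF assms, of u R n] that by simp
  then show ?thesis
    unfolding csc_lattice_def by blast
qed

lemma open_strip_minus_lattice:
  assumes "p > 0"
  shows "open ({u. \<bar>Im u\<bar> < R} - csc_lattice p)"
  unfolding strip_minus_lattice_eq[OF assms]
  using finite_near_rows[OF assms]
  by (intro open_Int open_INT open_Collect_less open_Collect_neq ballI continuous_intros)

lemma Union_strips: "(\<Union>R. {u. \<bar>Im u\<bar> < R} - csc_lattice p) = - csc_lattice p"
  by (auto intro: gt_ex)

lemma open_minus_lattice:
  assumes "p > 0"
  shows "open (- csc_lattice p)"
  using open_UN[of UNIV "\<lambda>R. {u. \<bar>Im u\<bar> < R} - csc_lattice p"] open_strip_minus_lattice[OF assms]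
  unfolding Union_strips by blast

lemma holomorphic_csc_sum:
  assumes "p > 0" "j > 0"
  shows "csc_sum j p holomorphic_on - csc_lattice p"
proof -
  have "csc_sum j p holomorphic_on {u. \<bar>Im u\<bar> < R} - csc_lattice p" for R
  proof -
    have "csc_sum j p = (\<lambda>u. (\<Sum>n\<in>near_rows p R. 1 / sin (u + \<i> * of_real (of_int n * p)) ^ j) +
           (\<Sum>\<^sub>\<infinity>n\<in>- near_rows p R. 1 / sin (u + \<i> * of_real (of_int n * p)) ^ j))"
      using csc_sum_split[OF assms] by blast
    moreover have "\<dots> holomorphic_on {u. \<bar>Im u\<bar> < R} - csc_lattice p"
      by (intro holomorphic_intros holomorphic_on_subset[OF holomorphic_far_rows[OF assms]])
         (auto simp: csc_lattice_def)
    ultimately show ?thesis by simp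
  qed
  then show ?thesis
    using holomorphic_on_UN_open[of UNIV "csc_sum j p" "\<lambda>R. {u. \<bar>Im u\<bar> < R} - csc_lattice p"]
      open_strip_minus_lattice[OF assms(1)]
    unfolding Union_strips by blast
qed

text \<open>Since \<open>1 / 0 = 0\<close>, the function below is given by the sum over \<open>n \<noteq> 0\<close> at \<open>u = 0\<close> as well.\<close>

lemma holomorphic_csc_sum_minus_csc:
  assumes "p > 0" "j > 0"
  shows "(\<lambda>u. csc_sum j p u - 1 / sin u ^ j) holomorphic_on {u. \<bar>Im u\<bar> < p}"
proof -
  have 0: "0 \<in> near_rows p p"
    using assms by (simp add: near_rows_def)
  have "csc_sum j p u - 1 / sin u ^ j =
      (\<Sum>n\<in>near_rows p p - {0}. 1 / sin (u + \<i> * of_real (of_int n * p)) ^ j) +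
      (\<Sum>\<^sub>\<infinity>n\<in>- near_rows p p. 1 / sin (u + \<i> * of_real (of_int n * p)) ^ j)" for u
    using csc_sum_split[OF assms, of u p]
      sum.remove[OF finite_near_rows[OF assms(1), of p] 0, of "\<lambda>n. 1 / sin (u + \<i> * of_real (of_int n * p)) ^ j"]
    by (simp add: algebra_simps)
  moreover have "sin (u + \<i> * of_real (of_int n * p)) \<noteq> 0" if "\<bar>Im u\<bar> < p" "n \<noteq> 0" for u and n :: int
  proof
    assume "sin (u + \<i> * of_real (of_int n * p)) = 0"
    then have "Im (u + \<i> * of_real (of_int n * p)) = 0"
      unfolding sin_eq_0 by (metis Im_complex_of_real)
    then have "Im u = - (of_int n * p)" by simp
    then have "\<bar>Im u\<bar> = \<bar>of_int n\<bar> * p"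
      using assms by (simp add: abs_mult)
    moreover have "1 * p \<le> \<bar>of_int n\<bar> * p"
      using \<open>n \<noteq> 0\<close> assms by (intro mult_right_mono) (auto simp: abs_if)
    ultimately show False using that by linarith
  qed
  ultimately show ?thesis
    by (simp only:, intro holomorphic_intros holomorphic_far_rows[OF assms]) auto
qed

lemma inverse_minus_power: "1 / (- s) ^ j = (-1) ^ j * (1 / s ^ j)" for s :: complex
  by (cases "even j") auto

lemma csc_sum_shift_row: "csc_sum j p (u + \<i> * of_real p) = csc_sum j p u"
  unfolding csc_sum_def
  by (rule infsum_reindex_bij_witness[of _ "\<lambda>n. n - 1" "\<lambda>n. n + 1"]) (auto simp: algebra_simps)

lemma csc_sum_shift_pi: "csc_sum j p (u + of_real pi) = (-1) ^ j * csc_sum j p u"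
proof -
  have "sin (u + of_real pi + v) = - sin (u + v)" for v :: complex
    by (simp add: sin_add cos_add)
  then have "1 / sin (u + of_real pi + v) ^ j = (-1) ^ j * (1 / sin (u + v) ^ j)" for v :: complex
    by (simp only: inverse_minus_power)
  then show ?thesis
    unfolding csc_sum_def by (simp only: infsum_cmult_right')
qed

lemma csc_sum_minus: "csc_sum j p (- u) = (-1) ^ j * csc_sum j p u"
proof -
  have "csc_sum j p (- u) = (\<Sum>\<^sub>\<infinity>n::int. (-1) ^ j * (1 / sin (u + \<i> * of_real (of_int n * p)) ^ j))"
    unfolding csc_sum_def
  proof (rule infsum_reindex_bij_witness[of _ uminus uminus])
    fix n :: int
    have "sin (- u + \<i> * of_real (of_int n * p)) = - sin (u + \<i> * of_real (of_int (- n) * p))"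
      by (subst sin_minus[symmetric]) (simp add: algebra_simps)
    then show "(-1) ^ j * (1 / sin (u + \<i> * of_real (of_int (- n) * p)) ^ j) =
                1 / sin (- u + \<i> * of_real (of_int n * p)) ^ j"
      by (simp only: inverse_minus_power)
  qed auto
  then show ?thesis
    unfolding csc_sum_def by (simp only: infsum_cmult_right')
qed

lemma cnj_csc_sum: "cnj (csc_sum j p u) = csc_sum j p (cnj u)"
proof -
  have "cnj (csc_sum j p u) = (\<Sum>\<^sub>\<infinity>n::int. cnj (1 / sin (u + \<i> * of_real (of_int n * p)) ^ j))"
    by (simp only: csc_sum_def infsum_cnj)
  also have "\<dots> = csc_sum j p (cnj u)"
    unfolding csc_sum_def
    by (rule infsum_reindex_bij_witness[of _ uminus uminus]) (auto simp: cnj_sin)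
  finally show ?thesis .
qed

section \<open>Doubly periodic functions\<close>

lemma csc_lattice_iff:
  "u \<in> csc_lattice p \<longleftrightarrow> (\<exists>m n :: int. u = of_int m * of_real pi + of_int n * (\<i> * of_real p))"
proof -
  have "sin (u + \<i> * of_real (of_int n * p)) = 0 \<longleftrightarrow>
        (\<exists>m :: int. u = of_int m * of_real pi + of_int (- n) * (\<i> * of_real p))" for n :: int
    by (auto simp: sin_eq_0 algebra_simps eq_diff_eq)
  then have "u \<in> csc_lattice p \<longleftrightarrow>
      (\<exists>n m :: int. u = of_int m * of_real pi + of_int (- n) * (\<i> * of_real p))"
    by (simp add: csc_lattice_def)
  also have "\<dots> \<longleftrightarrow> (\<exists>m n :: int. u = of_int m * of_real pi + of_int n * (\<i> * of_real p))"
  proof (safe, goal_cases)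
    case (1 n m)
    show ?case by (rule exI[of _ m], rule exI[of _ "- n"]) simp
  next
    case (2 m n)
    show ?case by (rule exI[of _ "- n"], rule exI[of _ m]) simp
  qed
  finally show ?thesis .
qed

lemma csc_lattice_shift:
  "u + of_real pi \<in> csc_lattice p \<longleftrightarrow> u \<in> csc_lattice p"
  "u + \<i> * of_real p \<in> csc_lattice p \<longleftrightarrow> u \<in> csc_lattice p"
proof -
  have "(u + of_int m * of_real pi + of_int n * (\<i> * of_real p)) \<in> csc_lattice p \<longleftrightarrow> u \<in> csc_lattice p"
    for m n :: int
  proof
    assume "u + of_int m * of_real pi + of_int n * (\<i> * of_real p) \<in> csc_lattice p"
    then obtain a b :: int
      where "u + of_int m * of_real pi + of_int n * (\<i> * of_real p) =
               of_int a * of_real pi + of_int b * (\<i> * of_real p)"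
      unfolding csc_lattice_iff by blast
    then have "u = of_int (a - m) * of_real pi + of_int (b - n) * (\<i> * of_real p)"
      by (simp add: algebra_simps eq_diff_eq)
    then show "u \<in> csc_lattice p" unfolding csc_lattice_iff by blast
  next
    assume "u \<in> csc_lattice p"
    then obtain a b :: int where "u = of_int a * of_real pi + of_int b * (\<i> * of_real p)"
      unfolding csc_lattice_iff by blast
    then have "u + of_int m * of_real pi + of_int n * (\<i> * of_real p) =
       of_int (a + m) * of_real pi + of_int (b + n) * (\<i> * of_real p)"
      by (simp add: algebra_simps)
    then show "u + of_int m * of_real pi + of_int n * (\<i> * of_real p) \<in> csc_lattice p"
      unfolding csc_lattice_iff by blast
  qed
  from this[of 1 0] this[of 0 1]
  show "u + of_real pi \<in> csc_lattice p \<longleftrightarrow> u \<in> csc_lattice p"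
    "u + \<i> * of_real p \<in> csc_lattice p \<longleftrightarrow> u \<in> csc_lattice p"
    by simp_all
qed

lemma csc_lattice_0: "0 \<in> csc_lattice p"
  unfolding csc_lattice_def by (auto intro: exI[of _ 0])

lemma not_in_csc_lattice_near_0:
  assumes "p > 0" "norm u < min pi p" "u \<noteq> 0"
  shows "u \<notin> csc_lattice p"
proof
  assume "u \<in> csc_lattice p"
  then obtain m n :: int where u: "u = of_int m * of_real pi + of_int n * (\<i> * of_real p)"
    unfolding csc_lattice_iff by blast
  have "\<bar>of_int m\<bar> * pi < 1 * pi" "\<bar>of_int n\<bar> * p < 1 * p"
  proof -
    have "\<bar>of_int m\<bar> * pi = \<bar>Re u\<bar>" "\<bar>of_int n\<bar> * p = \<bar>Im u\<bar>"
      using assms(1) by (simp_all add: u abs_mult)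
    then show "\<bar>of_int m\<bar> * pi < 1 * pi" "\<bar>of_int n\<bar> * p < 1 * p"
      using abs_Re_le_cmod[of u] abs_Im_le_cmod[of u] assms(2) by linarith+
  qed
  then have "\<bar>real_of_int m\<bar> < 1" "\<bar>real_of_int n\<bar> < 1"
    using assms(1) pi_gt_zero mult_less_cancel_right_pos by blast+
  then have "m = 0" "n = 0" by linarith+
  with u assms(3) show False by simp
qed

lemma periodic_of_int:
  fixes f :: "complex \<Rightarrow> 'a" and m :: int
  assumes "\<And>u. f (u + w) = f u"
  shows "f (u + of_int m * w) = f u"
proof -
  have nat: "f (u + of_nat k * w) = f u" for k u
  proof (induction k)
    case (Suc k)
    have "f (u + of_nat (Suc k) * w) = f (u + of_nat k * w + w)" by (simp add: algebra_simps)
    then show ?case using assms Suc by simp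
  qed auto
  show ?thesis
  proof (cases "m \<ge> 0")
    case True
    then show ?thesis using nat[of u "nat m"] by simp
  next
    case False
    then show ?thesis using nat[of "u + of_int m * w" "nat (- m)"] by simp
  qed
qed

text \<open>Giving all lattice points the one value \<open>g 0\<close> keeps the extension periodic.
  Translation then carries the removable singularity from 0 to every lattice point, the values on
  one compact period rectangle bound the function, and Liouville applies.\<close>

lemma doubly_periodic_constant:
  assumes p: "p > 0"
    and hol: "\<phi> holomorphic_on - csc_lattice p"
    and per: "\<And>u. u \<notin> csc_lattice p \<Longrightarrow> \<phi> (u + of_real pi) = \<phi> u"
             "\<And>u. u \<notin> csc_lattice p \<Longrightarrow> \<phi> (u + \<i> * of_real p) = \<phi> u"
    and ext: "e > 0" "g holomorphic_on ball 0 e" "\<And>u. u \<in> ball 0 e - csc_lattice p \<Longrightarrow> \<phi> u = g u"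
  shows "\<exists>a. \<forall>u. u \<notin> csc_lattice p \<longrightarrow> \<phi> u = a"
proof -
  define \<Phi> where "\<Phi> u = (if u \<in> csc_lattice p then g 0 else \<phi> u)" for u
  have per1: "\<Phi> (u + of_int m * of_real pi) = \<Phi> u" for u and m :: int
    by (rule periodic_of_int) (auto simp: \<Phi>_def csc_lattice_shift per)
  have per2: "\<Phi> (u + of_int m * (\<i> * of_real p)) = \<Phi> u" for u and m :: int
    by (rule periodic_of_int) (auto simp: \<Phi>_def csc_lattice_shift per)
  define d where "d = min e (min pi p)"
  have d: "d > 0" using p ext(1) by (simp add: d_def)
  have near0: "\<Phi> u = g u" if "u \<in> ball 0 d" for u
  proof (cases "u = 0")
    case False
    then have "u \<notin> csc_lattice p"
      using that not_in_csc_lattice_near_0[OF p, of u] by (simp add: d_def)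
    with that ext(3)[of u] show ?thesis by (simp add: \<Phi>_def d_def)
  qed (simp add: \<Phi>_def csc_lattice_0)
  have "\<Phi> holomorphic_on UNIV"
  proof (subst holomorphic_on_open, simp, safe)
    fix z
    show "\<exists>f'. (\<Phi> has_field_derivative f') (at z)"
    proof (cases "z \<in> csc_lattice p")
      case True
      then obtain m n :: int where z: "z = of_int m * of_real pi + of_int n * (\<i> * of_real p)"
        unfolding csc_lattice_iff by blast
      have "\<Phi> u = g (u - z)" if "u \<in> ball z d" for u
      proof -
        have "\<Phi> u = \<Phi> ((u - z) + of_int m * of_real pi + of_int n * (\<i> * of_real p))"
          by (simp add: z)
        also have "\<dots> = \<Phi> (u - z)" unfolding per1 per2 ..
        also have "\<dots> = g (u - z)" using that by (intro near0) (auto simp: dist_norm norm_minus_commute)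
        finally show ?thesis .
      qed
      moreover have "(\<lambda>u. g (u - z)) holomorphic_on ball z d"
        using ext(2) by (intro holomorphic_on_compose_gen[of "\<lambda>u. u - z" _ g, unfolded o_def] holomorphic_intros)
          (auto simp: d_def dist_norm norm_minus_commute)
      ultimately have "\<Phi> holomorphic_on ball z d"
        by (metis holomorphic_transform)
      then show ?thesis using d by (subst (asm) holomorphic_on_open) auto
    next
      case False
      have "\<Phi> holomorphic_on - csc_lattice p"
        by (rule holomorphic_transform[OF hol]) (simp add: \<Phi>_def)
      then show ?thesis
        using False open_minus_lattice[OF p] by (subst (asm) holomorphic_on_open) auto
    qed
  qed
  moreover have "bounded (range \<Phi>)"
  proof (rule bounded_subset)
    show "bounded (\<Phi> ` cbox 0 (Complex pi p))"
      using \<open>\<Phi> holomorphic_on UNIV\<close>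
      by (intro compact_imp_bounded compact_continuous_image compact_cbox
            continuous_on_subset[OF holomorphic_on_imp_continuous_on]) auto
    show "range \<Phi> \<subseteq> \<Phi> ` cbox 0 (Complex pi p)"
    proof safe
      fix u
      define m where "m = \<lfloor>Re u / pi\<rfloor>"
      define n where "n = \<lfloor>Im u / p\<rfloor>"
      define v where "v = u - of_int m * of_real pi - of_int n * (\<i> * of_real p)"
      have "of_int m * pi \<le> Re u" "Re u \<le> (of_int m + 1) * pi"
        using floor_divide_lower[of pi "Re u"] floor_divide_upper[of pi "Re u"]
        by (auto simp: m_def intro: less_imp_le)
      moreover have "of_int n * p \<le> Im u" "Im u \<le> (of_int n + 1) * p"
        using floor_divide_lower[of p "Im u"] floor_divide_upper[of p "Im u"] p
        by (auto simp: n_def intro: less_imp_le)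
      ultimately have "v \<in> cbox 0 (Complex pi p)"
        by (auto simp: v_def in_cbox_complex_iff algebra_simps)
      moreover have "\<Phi> u = \<Phi> (v + of_int m * of_real pi + of_int n * (\<i> * of_real p))"
        by (simp add: v_def)
      then have "\<Phi> u = \<Phi> v" unfolding per1 per2 .
      ultimately show "\<Phi> u \<in> \<Phi> ` cbox 0 (Complex pi p)" by blast
    qed
  qed
  ultimately have "\<Phi> constant_on UNIV" by (rule Liouville_theorem)
  then obtain a where "\<And>u. \<Phi> u = a" unfolding constant_on_def by auto
  then show ?thesis by (intro exI[of _ a]) (metis \<Phi>_def)
qed

text \<open>Riemann's criterion on a disc that contains no lattice point other than 0.\<close>

lemma removable_at_0:
  assumes p: "p > 0" and hol: "\<phi> holomorphic_on - csc_lattice p"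
    and lim: "((\<lambda>u. u * \<phi> u) \<longlongrightarrow> 0) (at 0)"
  obtains e g where "e > 0" "g holomorphic_on ball 0 e" "\<And>u. u \<in> ball 0 e - csc_lattice p \<Longrightarrow> \<phi> u = g u"
proof -
  have "\<phi> holomorphic_on ball 0 (min pi p) - {0}"
    by (rule holomorphic_on_subset[OF hol]) (use not_in_csc_lattice_near_0[OF p] in auto)
  then obtain g where "g holomorphic_on ball 0 (min pi p)" "\<forall>z\<in>ball 0 (min pi p) - {0}. g z = \<phi> z"
    using holomorphic_on_extend_lim[of \<phi> "ball 0 (min pi p)" 0] lim p by auto
  then show thesis
    using p csc_lattice_0[of p] by (intro that[of "min pi p" g]) (simp, assumption, metis Diff_iff singletonD)
qed

lemma deriv_shift:
  assumes F: "F holomorphic_on S" "open S" and eq: "\<And>v. v \<in> S \<Longrightarrow> F (v + w) = \<sigma> * F v"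
    and u: "u \<in> S" "u + w \<in> S"
  shows "deriv F (u + w) = \<sigma> * deriv F u"
proof -
  have "(F has_field_derivative deriv F (u + w)) (at (u + w))"
    using assms by (intro holomorphic_derivI)
  then have "((\<lambda>v. F (v + w)) has_field_derivative deriv F (u + w)) (at u)"
    by (simp add: DERIV_shift)
  moreover have "((\<lambda>v. \<sigma> * F v) has_field_derivative \<sigma> * deriv F u) (at u)"
    using assms by (intro DERIV_cmult holomorphic_derivI)
  then have "((\<lambda>v. F (v + w)) has_field_derivative \<sigma> * deriv F u) (at u)"
    by (rule has_field_derivative_transform_within_open[OF _ F(2) u(1)]) (simp add: eq)
  ultimately show ?thesis by (rule DERIV_unique)
qed

lemma deriv_reflect:
  assumes F: "F holomorphic_on S" "open S" and eq: "\<And>v. v \<in> S \<Longrightarrow> F (- v) = \<sigma> * F v"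
    and u: "u \<in> S" "- u \<in> S"
  shows "deriv F (- u) = - \<sigma> * deriv F u"
proof -
  have "(F has_field_derivative deriv F (- u)) (at (- u))"
    using assms by (intro holomorphic_derivI)
  then have "((\<lambda>v. F (- v)) has_field_derivative deriv F (- u) * (- 1)) (at u)"
    by (rule DERIV_chain2) (auto intro!: derivative_eq_intros)
  then have "((\<lambda>v. F (- v)) has_field_derivative - deriv F (- u)) (at u)"
    by simp
  moreover have "((\<lambda>v. \<sigma> * F v) has_field_derivative \<sigma> * deriv F u) (at u)"
    using assms by (intro DERIV_cmult holomorphic_derivI)
  then have "((\<lambda>v. F (- v)) has_field_derivative \<sigma> * deriv F u) (at u)"
    by (rule has_field_derivative_transform_within_open[OF _ F(2) u(1)]) (simp add: eq)
  ultimately have "- deriv F (- u) = \<sigma> * deriv F u" by (rule DERIV_unique)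
  then show ?thesis by (metis minus_minus mult_minus_left)
qed

lemma tendsto_id_over_sin: "((\<lambda>u :: complex. u / sin u) \<longlongrightarrow> 1) (at 0)"
proof -
  have "(sin has_field_derivative 1) (at (0 :: complex))"
    by (auto intro!: derivative_eq_intros)
  then have "((\<lambda>u :: complex. sin u / u) \<longlongrightarrow> 1) (at 0)"
    by (simp add: has_field_derivative_iff)
  from tendsto_inverse[OF this] show ?thesis by simp
qed

section \<open>The quadratic relation and the differential equation of the cosecant sums\<close>

locale csc_sums =
  fixes p :: real
  assumes p_pos: "p > 0"
begin

abbreviation "L \<equiv> csc_lattice p"

text \<open>In classical terms \<open>N u = A ns (A u)\<close> for the Jacobi function \<open>ns\<close> of modulus \<open>k\<close>, where the
  constants \<open>A = 2 K(k) / \<pi>\<close> and \<open>k\<close> are introduced below, and \<open>P\<close> is \<open>\<wp>\<close> up to an additive constant.\<close>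

definition "N = csc_sum 1 p"
definition "P = csc_sum 2 p"
definition "r u = N u - 1 / sin u"
definition "rP u = P u - 1 / sin u ^ 2"
text \<open>The coefficient for which \<open>deriv (deriv N) - 2 * N ^ 3 - c * N\<close> loses its
  simple pole at 0: the second derivative of \<open>1 / sin\<close> contributes
  \<open>- 1 / sin\<close>, and the cross term \<open>6 * r / sin ^ 2\<close> of the doubled cube
  behaves like \<open>6 * deriv r 0 / sin\<close>. The next constant \<open>a\<close> is the limit
  of \<open>N ^ 2 - P\<close> at 0.\<close>

definition "c = - 1 - 6 * deriv r 0"
definition "a = 2 * deriv r 0 - rP 0"

lemma open_L: "open (- L)"
  by (rule open_minus_lattice[OF p_pos])

lemma minus_in_L: "- u \<in> L \<longleftrightarrow> u \<in> L"
proof -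
  have "- u \<in> L" if "u \<in> L" for u
  proof -
    from that obtain m n :: int where "u = of_int m * of_real pi + of_int n * (\<i> * of_real p)"
      unfolding csc_lattice_iff by blast
    then have "- u = of_int (- m) * of_real pi + of_int (- n) * (\<i> * of_real p)" by simp
    then show ?thesis unfolding csc_lattice_iff by blast
  qed
  from this[of u] this[of "- u"] show ?thesis by auto
qed

lemma Im_not_in_L:
  assumes "0 < \<bar>Im u\<bar>" "\<bar>Im u\<bar> < p"
  shows "u \<notin> L"
proof
  assume "u \<in> L"
  then obtain m n :: int where u: "u = of_int m * of_real pi + of_int n * (\<i> * of_real p)"
    unfolding csc_lattice_iff by blast
  have "\<bar>of_int n\<bar> * p = \<bar>Im u\<bar>"
    using p_pos by (simp add: u abs_mult)
  then have "0 < \<bar>real_of_int n\<bar>" "\<bar>of_int n\<bar> * p < 1 * p"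
    using assms p_pos by (auto intro: zero_less_mult_pos2)
  then have "0 < \<bar>real_of_int n\<bar>" "\<bar>real_of_int n\<bar> < 1"
    using p_pos mult_less_cancel_right_pos by blast+
  moreover from this have "n = 0" by linarith
  ultimately show False by simp
qed

lemma eventually_not_in_L: "\<forall>\<^sub>F u in at 0. u \<notin> L"
  unfolding eventually_at
  using not_in_csc_lattice_near_0[OF p_pos] p_pos by (intro exI[of _ "min pi p"]) auto

lemma N_holo: "N holomorphic_on - L" and P_holo: "P holomorphic_on - L"
  unfolding N_def P_def using p_pos by (auto intro: holomorphic_csc_sum)

lemma N'_holo: "deriv N holomorphic_on - L" and N''_holo: "deriv (deriv N) holomorphic_on - L"
  using N_holo open_L by (auto intro!: holomorphic_deriv)

lemma open_strip: "open {u. \<bar>Im u\<bar> < p}"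
  by (intro open_Collect_less continuous_intros)

lemma r_holo: "r holomorphic_on {u. \<bar>Im u\<bar> < p}"
  using holomorphic_csc_sum_minus_csc[OF p_pos, of 1] unfolding r_def N_def by simp

lemma rP_holo: "rP holomorphic_on {u. \<bar>Im u\<bar> < p}"
  using holomorphic_csc_sum_minus_csc[OF p_pos, of 2] unfolding rP_def P_def by simp

lemma N_pi: "N (u + of_real pi) = - N u" and P_pi: "P (u + of_real pi) = P u"
  by (simp_all add: N_def P_def csc_sum_shift_pi)

lemma N_row: "N (u + \<i> * of_real p) = N u" and P_row: "P (u + \<i> * of_real p) = P u"
  by (simp_all add: N_def P_def csc_sum_shift_row)

lemma N_minus: "N (- u) = - N u"
  by (simp add: N_def csc_sum_minus)

lemma cnj_N: "cnj (N u) = N (cnj u)"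
  by (simp add: N_def cnj_csc_sum)

text \<open>Oddness forces \<open>N 0 = 0\<close>, and \<open>1 / sin 0\<close> is 0 by
  convention.\<close>

lemma r_0: "r 0 = 0"
  using N_minus[of 0] by (simp add: r_def)

lemma tendsto_strip:
  assumes "f holomorphic_on {u. \<bar>Im u\<bar> < p}"
  shows "(f \<longlongrightarrow> f 0) (at 0)"
proof -
  have "isCont f 0"
    using holomorphic_on_imp_continuous_on[OF assms] open_strip p_pos
    by (auto simp: continuous_on_eq_continuous_at)
  then show ?thesis by (simp add: isCont_def)
qed

lemma r_over_sin: "((\<lambda>u. r u / sin u) \<longlongrightarrow> deriv r 0) (at 0)"
proof -
  have "(r has_field_derivative deriv r 0) (at 0)"
    using r_holo open_strip p_pos by (intro holomorphic_derivI) auto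
  then have "((\<lambda>u. r u / u) \<longlongrightarrow> deriv r 0) (at 0)"
    by (simp add: has_field_derivative_iff r_0)
  then have "((\<lambda>u. r u / u * (u / sin u)) \<longlongrightarrow> deriv r 0 * 1) (at 0)"
    by (intro tendsto_mult tendsto_id_over_sin)
  moreover have "\<forall>\<^sub>F u in at 0. r u / u * (u / sin u) = r u / sin u"
    using eventually_neq_at_within[of 0] by eventually_elim simp
  ultimately show ?thesis
    by (simp add: Lim_transform_eventually)
qed

lemma r_tendsto: "(r \<longlongrightarrow> 0) (at 0)"
  using tendsto_strip[OF r_holo] by (simp add: r_0)

text \<open>The double poles at 0 cancel, and the cross term \<open>2 * r u / sin u\<close> stays
  bounded because \<open>r\<close> vanishes at 0. Squaring turns the antiperiodicity of
  \<open>N\<close> under \<open>pi\<close> into periodicity, so the difference is an elliptic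
  function without poles.\<close>

lemma N_sq_minus_P:
  assumes "u \<notin> L"
  shows "N u ^ 2 - P u = a"
proof -
  define \<phi> where "\<phi> u = N u ^ 2 - P u" for u
  have eq: "\<phi> u = 2 * (r u / sin u) + r u ^ 2 - rP u" for u
    by (simp add: \<phi>_def r_def rP_def power2_eq_square algebra_simps add_divide_distrib diff_divide_distrib)
  have "((\<lambda>u. 2 * (r u / sin u) + r u ^ 2 - rP u) \<longlongrightarrow> 2 * deriv r 0 + 0 ^ 2 - rP 0) (at 0)"
    by (intro tendsto_intros r_over_sin r_tendsto tendsto_strip rP_holo)
  then have lim: "(\<phi> \<longlongrightarrow> a) (at 0)"
    using ext[of \<phi>, OF eq] by (simp add: a_def)
  have hol: "\<phi> holomorphic_on - L"
    unfolding \<phi>_def by (intro holomorphic_intros N_holo P_holo)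
  have "((\<lambda>u. u * \<phi> u) \<longlongrightarrow> 0 * a) (at 0)"
    by (intro tendsto_intros lim)
  then have "((\<lambda>u. u * \<phi> u) \<longlongrightarrow> 0) (at 0)" by simp
  from removable_at_0[OF p_pos hol this] obtain e g
    where "e > 0" "g holomorphic_on ball 0 e" "\<And>u. u \<in> ball 0 e - L \<Longrightarrow> \<phi> u = g u"
    by blast
  from doubly_periodic_constant[OF p_pos hol _ _ this] obtain b where b: "\<And>u. u \<notin> L \<Longrightarrow> \<phi> u = b"
    by (auto simp: \<phi>_def N_pi P_pi N_row P_row)
  have "(\<phi> \<longlongrightarrow> b) (at 0)"
    by (rule tendsto_eventually) (use eventually_not_in_L in eventually_elim, rule b)
  with lim have "a = b" by (intro tendsto_unique) auto
  with b[OF assms] show ?thesis by (simp add: \<phi>_def)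
qed

lemma N''_near_0:
  assumes "norm u < min pi p" "u \<noteq> 0"
  shows "deriv (deriv N) u = 2 / sin u ^ 3 - 1 / sin u + deriv (deriv r) u"
proof -
  define B where "B = ball 0 (min pi p) - {0 :: complex}"
  have B: "open B" "u \<in> B" using assms by (auto simp: B_def)
  have strip: "v \<in> {u. \<bar>Im u\<bar> < p}" if "v \<in> B" for v
    using that abs_Im_le_cmod[of v] by (auto simp: B_def)
  have sin: "sin v \<noteq> 0" if "v \<in> B" for v
    using that not_in_csc_lattice_near_0[OF p_pos, of v] unfolding csc_lattice_def B_def
    by (auto dest: spec[of _ 0])
  have r1: "(r has_field_derivative deriv r v) (at v)" if "v \<in> B" for v
    using strip[OF that] r_holo open_strip by (intro holomorphic_derivI)
  have r2: "(deriv r has_field_derivative deriv (deriv r) v) (at v)" if "v \<in> B" for v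
    using strip[OF that] r_holo open_strip by (intro holomorphic_derivI[OF holomorphic_deriv])
  have N: "N = (\<lambda>v. 1 / sin v + r v)" by (simp add: r_def)
  have d1: "deriv N v = - cos v / sin v ^ 2 + deriv r v" if "v \<in> B" for v
    unfolding N by (rule DERIV_imp_deriv)
      (auto intro!: derivative_eq_intros r1 that simp: sin[OF that] power2_eq_square)
  have "(deriv N has_field_derivative 2 / sin u ^ 3 - 1 / sin u + deriv (deriv r) u) (at u)"
  proof (rule has_field_derivative_transform_within_open[OF _ B])
    let ?D = "- ((- (sin u * sin u ^ 2) - cos u * (2 * (cos u * sin u))) / sin u ^ 4)"
    have "?D = (sin u * sin u ^ 2 + cos u * (2 * (cos u * sin u))) / sin u ^ 4"
      by (simp add: diff_divide_distrib add_divide_distrib)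
    also have "sin u * sin u ^ 2 + cos u * (2 * (cos u * sin u)) = 2 * sin u - sin u ^ 3"
      using sin_cos_squared_add3[of u] by algebra
    also have "(2 * sin u - sin u ^ 3) / sin u ^ 4 = 2 / sin u ^ 3 - 1 / sin u"
      using sin[OF B(2)] by (simp add: field_simps eval_nat_numeral)
    finally have D: "?D = 2 / sin u ^ 3 - 1 / sin u" .
    have "((\<lambda>v. - cos v / sin v ^ 2 + deriv r v) has_field_derivative ?D + deriv (deriv r) u) (at u)"
      using sin[OF B(2)] by (auto intro!: derivative_eq_intros r2 B(2))
    then show "((\<lambda>v. - cos v / sin v ^ 2 + deriv r v) has_field_derivative
            2 / sin u ^ 3 - 1 / sin u + deriv (deriv r) u) (at u)"
      unfolding D .
  qed (simp add: d1)
  then show ?thesis by (rule DERIV_imp_deriv)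
qed

lemma L_shifts: "u \<notin> L \<Longrightarrow> u + of_real pi \<notin> L" "u \<notin> L \<Longrightarrow> u + \<i> * of_real p \<notin> L" "u \<notin> L \<Longrightarrow> - u \<notin> L"
  by (simp_all add: csc_lattice_shift minus_in_L)

lemma N'_pi: "u \<notin> L \<Longrightarrow> deriv N (u + of_real pi) = - deriv N u"
  using deriv_shift[OF N_holo open_L, of "of_real pi" "-1" u] by (simp add: N_pi L_shifts)
lemma N'_row: "u \<notin> L \<Longrightarrow> deriv N (u + \<i> * of_real p) = deriv N u"
  using deriv_shift[OF N_holo open_L, of "\<i> * of_real p" 1 u] by (simp add: N_row L_shifts)
lemma N'_minus: "u \<notin> L \<Longrightarrow> deriv N (- u) = deriv N u"
  using deriv_reflect[OF N_holo open_L, of "-1" u] by (simp add: N_minus L_shifts)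
lemma N''_pi: "u \<notin> L \<Longrightarrow> deriv (deriv N) (u + of_real pi) = - deriv (deriv N) u"
  using deriv_shift[OF N'_holo open_L, of "of_real pi" "-1" u] by (simp add: N'_pi L_shifts)
lemma N''_row: "u \<notin> L \<Longrightarrow> deriv (deriv N) (u + \<i> * of_real p) = deriv (deriv N) u"
  using deriv_shift[OF N'_holo open_L, of "\<i> * of_real p" 1 u] by (simp add: N'_row L_shifts)
lemma N''_minus: "u \<notin> L \<Longrightarrow> deriv (deriv N) (- u) = - deriv (deriv N) u"
  using deriv_reflect[OF N'_holo open_L, of "1" u] by (simp add: N'_minus L_shifts)

lemma N_ode:
  assumes "u \<notin> L"
  shows "deriv (deriv N) u = 2 * N u ^ 3 + c * N u"
proof -
  define \<phi> where "\<phi> u = deriv (deriv N) u - 2 * N u ^ 3 - c * N u" for u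
  have hol: "\<phi> holomorphic_on - L"
    unfolding \<phi>_def by (intro holomorphic_intros N_holo N''_holo)
  \<comment> \<open>This is \<open>u * \<phi> u\<close> expanded in \<open>1 / sin u\<close> and
    \<open>r u\<close> after the cubic poles have cancelled; the value of \<open>c\<close> has been
    inserted in the multiple of \<open>u / sin u\<close>. Only bounded quotients remain, and the two
    nonzero limits are \<open>6 * deriv r 0\<close> and its negative.\<close>
  define \<psi> where "\<psi> u = u * deriv (deriv r) u + 6 * deriv r 0 * (u / sin u) - 6 * (u / sin u) * (r u / sin u)
     - 6 * (u / sin u) * r u ^ 2 - 2 * u * r u ^ 3 - c * u * r u" for u
  have "deriv (deriv r) holomorphic_on {u. \<bar>Im u\<bar> < p}"
    using r_holo open_strip by (intro holomorphic_deriv)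
  then have "(\<psi> \<longlongrightarrow> 0 * deriv (deriv r) 0 + 6 * deriv r 0 * 1 - 6 * 1 * deriv r 0 - 6 * 1 * 0 ^ 2
      - 2 * 0 * 0 ^ 3 - c * 0 * 0) (at 0)"
    unfolding \<psi>_def
    by (intro tendsto_intros tendsto_id_over_sin r_over_sin r_tendsto tendsto_strip)
  then have "(\<psi> \<longlongrightarrow> 0) (at 0)" by simp
  moreover have "\<forall>\<^sub>F u in at 0. \<psi> u = u * \<phi> u"
    unfolding eventually_at
  proof (intro exI[of _ "min pi p"] conjI ballI impI)
    fix u :: complex assume "u \<noteq> 0 \<and> dist u 0 < min pi p"
    then have u: "norm u < min pi p" "u \<noteq> 0" by auto
    have N: "N u = 1 / sin u + r u" by (simp add: r_def)
    define s where "s = 1 / sin u"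
    have "\<phi> u = 2 * s ^ 3 - s + deriv (deriv r) u - 2 * (s + r u) ^ 3 - c * (s + r u)"
      by (simp add: \<phi>_def N''_near_0[OF u] N s_def power_divide)
    moreover have "\<psi> u = u * deriv (deriv r) u + 6 * deriv r 0 * (u * s) - 6 * (u * s) * (r u * s)
      - 6 * (u * s) * r u ^ 2 - 2 * u * r u ^ 3 - c * u * r u"
      by (simp add: \<psi>_def s_def)
    ultimately show "\<psi> u = u * \<phi> u"
      unfolding c_def by algebra
  qed (use p_pos in auto)
  ultimately have "((\<lambda>u. u * \<phi> u) \<longlongrightarrow> 0) (at 0)"
    by (rule Lim_transform_eventually)
  \<comment> \<open>\<open>\<phi>\<close> is only antiperiodic under \<open>\<pi>\<close>, so it is \<open>\<phi>\<^sup>2\<close> that is constant; oddness gives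
    \<open>\<phi> = 0\<close> at the half period \<open>\<i> p / 2\<close>.\<close>
  from removable_at_0[OF p_pos hol this] obtain e g
    where g: "e > 0" "g holomorphic_on ball 0 e" "\<And>u. u \<in> ball 0 e - L \<Longrightarrow> \<phi> u = g u"
    by blast
  have per: "\<phi> (u + of_real pi) = - \<phi> u" "\<phi> (u + \<i> * of_real p) = \<phi> u" "\<phi> (- u) = - \<phi> u"
    if "u \<notin> L" for u
    using that by (simp_all add: \<phi>_def N_pi N_row N_minus N''_pi N''_row N''_minus)
  have "\<exists>b. \<forall>u. u \<notin> L \<longrightarrow> \<phi> u ^ 2 = b"
    by (rule doubly_periodic_constant[OF p_pos _ _ _ g(1), of _ "\<lambda>u. g u ^ 2"])
       (auto intro!: holomorphic_intros hol g(2) simp: per g(3))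
  then obtain b where b: "\<And>u. u \<notin> L \<Longrightarrow> \<phi> u ^ 2 = b" by blast
  define h where "h = \<i> * of_real p / 2"
  have h: "h \<notin> L" using p_pos by (intro Im_not_in_L) (auto simp: h_def)
  have "\<phi> (- h + \<i> * of_real p) = \<phi> (- h)" "\<phi> (- h) = - \<phi> h"
    using h by (intro per L_shifts; simp)+
  moreover have "- h + \<i> * of_real p = h" by (simp add: h_def)
  ultimately have "\<phi> h = 0" by simp
  with b[OF h] b[OF assms] have "\<phi> u = 0" by simp
  then show ?thesis by (simp add: \<phi>_def algebra_simps)
qed

end

section \<open>Elliptic integrals\<close>

text \<open>The antiderivative is \<open>F\<close> composed with the inverse of \<open>w\<close>.
  The fundamental theorem is used in the form that asks for derivatives only in the interior, since
  the integrand is singular at 1 and continuity of the inverse up to the endpoint is all that is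
  available there. The weight \<open>\<phi>\<close> serves \<open>K\<close> and \<open>E\<close> at
  once.\<close>

lemma elliptic_substitution:
  fixes w F \<phi> :: "real \<Rightarrow> real"
  assumes T: "T > 0" and A: "A > 0" and k: "k\<^sup>2 < 1"
    and w: "continuous_on {0..T} w" "w 0 = 0" "w T = 1"
    and w_bd: "\<And>t. 0 < t \<Longrightarrow> t < T \<Longrightarrow> 0 \<le> w t \<and> w t < 1"
    and w_deriv: "\<And>t. 0 < t \<Longrightarrow> t < T \<Longrightarrow>
          (w has_real_derivative A * sqrt ((1 - (w t)\<^sup>2) * (1 - k\<^sup>2 * (w t)\<^sup>2))) (at t)"
    and F: "continuous_on {0..T} F"
    and F_deriv: "\<And>t. 0 < t \<Longrightarrow> t < T \<Longrightarrow> (F has_real_derivative A * \<phi> (w t)) (at t)"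
  shows "((\<lambda>v. \<phi> v / sqrt ((1 - v\<^sup>2) * (1 - k\<^sup>2 * v\<^sup>2))) has_integral (F T - F 0)) {0..1}"
proof -
  have rad_pos: "0 < (1 - v\<^sup>2) * (1 - k\<^sup>2 * v\<^sup>2)" if "0 \<le> v" "v < 1" for v :: real
  proof -
    have v: "v\<^sup>2 < 1" using that by (simp add: power_less_one_iff)
    have "k\<^sup>2 * v\<^sup>2 \<le> 1 * v\<^sup>2" using k by (intro mult_right_mono) auto
    with v show ?thesis by (intro mult_pos_pos) auto
  qed
  have mono: "w s < w t" if "0 \<le> s" "s < t" "t \<le> T" for s t
  proof (rule DERIV_pos_imp_increasing_open[of s t w])
    fix x assume x: "s < x" "x < t"
    then show "\<exists>y. DERIV w x :> y \<and> y > 0"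
      using w_deriv[of x] rad_pos[of "w x"] w_bd[of x] that A
      by (intro exI[of _ "A * sqrt ((1 - (w x)\<^sup>2) * (1 - k\<^sup>2 * (w x)\<^sup>2))"]) auto
  qed (use that in \<open>auto intro: continuous_on_subset[OF w(1)]\<close>)
  have inj: "inj_on w {0..T}"
  proof (rule inj_onI)
    fix s t assume "s \<in> {0..T}" "t \<in> {0..T}" "w s = w t"
    then show "s = t"
      using mono[of s t] mono[of t s] by (cases s t rule: linorder_cases) auto
  qed
  have img: "w ` {0..T} = {0..1}"
  proof
    show "w ` {0..T} \<subseteq> {0..1}"
    proof
      fix y assume "y \<in> w ` {0..T}"
      then obtain t where t: "0 \<le> t" "t \<le> T" "y = w t" by auto
      then show "y \<in> {0..1}"
        using w_bd[of t] w by (cases "t = 0"; cases "t = T") auto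
    qed
    show "{0..1} \<subseteq> w ` {0..T}"
      using IVT'[of w 0 _ T] w T by force
  qed
  define \<theta> where "\<theta> = inv_into {0..T} w"
  have \<theta>_w: "\<theta> (w t) = t" if "t \<in> {0..T}" for t
    using inj that by (simp add: \<theta>_def)
  have w_\<theta>: "w (\<theta> v) = v" "\<theta> v \<in> {0..T}" if "v \<in> {0..1}" for v
    using that f_inv_into_f[of v w "{0..T}"] inv_into_into[of v w "{0..T}"] by (simp_all add: \<theta>_def img)
  have \<theta>_cont: "continuous_on {0..1} \<theta>"
    using continuous_on_inv[OF w(1) compact_Icc] \<theta>_w unfolding img by blast
  have \<theta>_int: "0 < \<theta> v" "\<theta> v < T" if "0 < v" "v < 1" for v
    using w_\<theta>[of v] that w by (auto simp: less_le)
  have deriv: "((F \<circ> \<theta>) has_real_derivative \<phi> v / sqrt ((1 - v\<^sup>2) * (1 - k\<^sup>2 * v\<^sup>2))) (at v)"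
    if v: "0 < v" "v < 1" for v
  proof -
    let ?R = "sqrt ((1 - v\<^sup>2) * (1 - k\<^sup>2 * v\<^sup>2))"
    have R: "?R > 0" using rad_pos[of v] v by simp
    have "DERIV \<theta> v :> inverse (A * ?R)"
    proof (rule DERIV_inverse_function[where a = 0 and b = 1])
      show "DERIV w (\<theta> v) :> A * ?R"
        using w_deriv[OF \<theta>_int[OF v]] w_\<theta>(1)[of v] v by simp
      show "isCont \<theta> v"
        using continuous_on_interior[OF \<theta>_cont, of v] v by simp
    qed (use v A R w_\<theta> in auto)
    moreover have "DERIV F (\<theta> v) :> A * \<phi> v"
      using F_deriv[OF \<theta>_int[OF v]] w_\<theta>(1)[of v] v by simp
    ultimately have "DERIV (F \<circ> \<theta>) v :> A * \<phi> v * inverse (A * ?R)"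
      by (rule DERIV_chain[rotated])
    then show ?thesis using A R by (simp add: field_simps)
  qed
  have "((\<lambda>v. \<phi> v / sqrt ((1 - v\<^sup>2) * (1 - k\<^sup>2 * v\<^sup>2))) has_integral ((F \<circ> \<theta>) 1 - (F \<circ> \<theta>) 0)) {0..1}"
  proof (rule fundamental_theorem_of_calculus_interior)
    have "\<theta> ` {0..1} \<subseteq> {0..T}" using w_\<theta>(2) by blast
    then show "continuous_on {0..1} (F \<circ> \<theta>)"
      by (intro continuous_on_compose \<theta>_cont continuous_on_subset[OF F])
  qed (use deriv in \<open>auto simp: o_def has_real_derivative_iff_has_vector_derivative\<close>)
  moreover have "\<theta> 1 = T" "\<theta> 0 = 0"
    using \<theta>_w[of T] \<theta>_w[of 0] w T by auto
  ultimately show ?thesis by simp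
qed

lemma elliptic_K_substitution:
  fixes w :: "real \<Rightarrow> real"
  assumes "T > 0" "A > 0" "k\<^sup>2 < 1" "continuous_on {0..T} w" "w 0 = 0" "w T = 1"
    and "\<And>t. 0 < t \<Longrightarrow> t < T \<Longrightarrow> 0 \<le> w t \<and> w t < 1"
    and "\<And>t. 0 < t \<Longrightarrow> t < T \<Longrightarrow>
          (w has_real_derivative A * sqrt ((1 - (w t)\<^sup>2) * (1 - k\<^sup>2 * (w t)\<^sup>2))) (at t)"
  shows "elliptic_K k = A * T"
proof -
  have "((\<lambda>v. 1 / sqrt ((1 - v\<^sup>2) * (1 - k\<^sup>2 * v\<^sup>2))) has_integral (A * T - A * 0)) {0..1}"
    by (rule elliptic_substitution[OF assms, where \<phi> = "\<lambda>_. 1"])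
       (auto intro!: derivative_eq_intros continuous_intros)
  then show ?thesis unfolding elliptic_K_def by (simp add: integral_unique)
qed

lemma elliptic_E_substitution:
  fixes w F :: "real \<Rightarrow> real"
  assumes "T > 0" "A > 0" "k\<^sup>2 < 1" "continuous_on {0..T} w" "w 0 = 0" "w T = 1"
    and "\<And>t. 0 < t \<Longrightarrow> t < T \<Longrightarrow> 0 \<le> w t \<and> w t < 1"
    and "\<And>t. 0 < t \<Longrightarrow> t < T \<Longrightarrow>
          (w has_real_derivative A * sqrt ((1 - (w t)\<^sup>2) * (1 - k\<^sup>2 * (w t)\<^sup>2))) (at t)"
    and F: "continuous_on {0..T} F"
    and F_deriv: "\<And>t. 0 < t \<Longrightarrow> t < T \<Longrightarrow> (F has_real_derivative A * (1 - k\<^sup>2 * (w t)\<^sup>2)) (at t)"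
  shows "elliptic_E k = F T - F 0"
proof -
  have "((\<lambda>v. (1 - k\<^sup>2 * v\<^sup>2) / sqrt ((1 - v\<^sup>2) * (1 - k\<^sup>2 * v\<^sup>2))) has_integral (F T - F 0)) {0..1}"
    by (rule elliptic_substitution[OF assms])
  \<comment> \<open>This includes \<open>v = 1\<close>, where both sides are 0 by division by
    zero.\<close>
  moreover have "(1 - k\<^sup>2 * v\<^sup>2) / sqrt ((1 - v\<^sup>2) * (1 - k\<^sup>2 * v\<^sup>2)) = sqrt ((1 - k\<^sup>2 * v\<^sup>2) / (1 - v\<^sup>2))"
    if "v \<in> {0..1}" for v
  proof -
    have "v\<^sup>2 \<le> 1" using that by (simp add: power_le_one)
    then have "k\<^sup>2 * v\<^sup>2 \<le> 1 * 1" using assms(3) by (intro mult_mono) auto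
    then have "1 - k\<^sup>2 * v\<^sup>2 \<ge> 0" by simp
    then have "(1 - k\<^sup>2 * v\<^sup>2) / sqrt (1 - k\<^sup>2 * v\<^sup>2) = sqrt (1 - k\<^sup>2 * v\<^sup>2)"
      by (rule real_div_sqrt)
    moreover have "(1 - k\<^sup>2 * v\<^sup>2) / sqrt ((1 - v\<^sup>2) * (1 - k\<^sup>2 * v\<^sup>2)) =
        (1 - k\<^sup>2 * v\<^sup>2) / sqrt (1 - k\<^sup>2 * v\<^sup>2) / sqrt (1 - v\<^sup>2)"
      by (simp only: real_sqrt_mult divide_divide_eq_left mult.commute)
    ultimately show ?thesis by (simp only: real_sqrt_divide)
  qed
  ultimately have "((\<lambda>v. sqrt ((1 - k\<^sup>2 * v\<^sup>2) / (1 - v\<^sup>2))) has_integral (F T - F 0)) {0..1}"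
    by (rule has_integral_eq[rotated])
  then show ?thesis unfolding elliptic_E_def by (simp add: integral_unique)
qed

section \<open>Monotonicity of \<open>K\<close> and uniqueness of the modulus\<close>

lemma elliptic_K_integrable:
  assumes "elliptic_K k \<noteq> 0"
  shows "(\<lambda>t. 1 / sqrt ((1 - t\<^sup>2) * (1 - k\<^sup>2 * t\<^sup>2))) integrable_on {0..1}"
  \<comment> \<open>A function that is not integrable has integral 0, so a nonzero value certifies
    convergence at the singular endpoint.\<close>
  using assms not_integrable_integral unfolding elliptic_K_def by blast

text \<open>Strictness needs a minorant of the difference of the integrands with positive integral.
  With \<open>r\<close>, \<open>s\<close>, \<open>q\<close> the three square roots, all at most 1,
  the difference is \<open>(s - r) / (q * r * s)\<close>, hence at least
  \<open>(s - r) * (s + r) / 2\<close>, which is \<open>d * t^2\<close>.\<close>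

lemma elliptic_K_strict_mono:
  assumes k: "0 \<le> k1" "k1 < k2" "k2 < 1" and nz: "elliptic_K k1 \<noteq> 0" "elliptic_K k2 \<noteq> 0"
  shows "elliptic_K k1 < elliptic_K k2"
proof -
  let ?f = "\<lambda>k t :: real. 1 / sqrt ((1 - t\<^sup>2) * (1 - k\<^sup>2 * t\<^sup>2))"
  have int: "(?f k1 has_integral elliptic_K k1) {0..1}" "(?f k2 has_integral elliptic_K k2) {0..1}"
    using elliptic_K_integrable[OF nz(1)] elliptic_K_integrable[OF nz(2)]
    by (simp_all add: elliptic_K_def has_integral_integral)
  define d where "d = (k2\<^sup>2 - k1\<^sup>2) / 2"
  have d: "d > 0" using k by (simp add: d_def power_strict_mono)
  have "((\<lambda>t. t ^ 2) has_integral (1 ^ 3 / 3 - 0 ^ 3 / 3)) {0..1 :: real}"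
    by (rule fundamental_theorem_of_calculus)
       (auto intro!: derivative_eq_intros simp flip: has_real_derivative_iff_has_vector_derivative)
  then have "((\<lambda>t. d * t\<^sup>2) has_integral (d * (1 / 3))) {0..1 :: real}"
    by (intro has_integral_mult_right) simp
  \<comment> \<open>At \<open>t = 1\<close> both integrands have the default value 0, so the
    minorant has to be lowered to 0 there.\<close>
  then have low: "((\<lambda>t. if t = 1 then 0 else d * t\<^sup>2) has_integral (d * (1 / 3))) {0..1 :: real}"
    by (rule has_integral_spike[of "{1}", rotated 2]) auto
  have "d * (1 / 3) \<le> elliptic_K k2 - elliptic_K k1"
  proof (rule has_integral_le[OF low has_integral_diff[OF int(2,1)]])
    fix t :: real assume t: "t \<in> {0..1}"
    show "(if t = 1 then 0 else d * t\<^sup>2) \<le> ?f k2 t - ?f k1 t"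
    proof (cases "t = 1")
      case False
      then have t1: "t\<^sup>2 < 1" using t by (simp add: power_less_one_iff)
      have kk: "k1\<^sup>2 \<le> k2\<^sup>2" "k2\<^sup>2 < 1"
        using k by (auto intro!: power_mono simp: power_less_one_iff)
      define r where "r = sqrt (1 - k2\<^sup>2 * t\<^sup>2)"
      define s where "s = sqrt (1 - k1\<^sup>2 * t\<^sup>2)"
      define q where "q = sqrt (1 - t\<^sup>2)"
      have "k2\<^sup>2 * t\<^sup>2 \<le> 1 * t\<^sup>2" using kk by (intro mult_right_mono) auto
      with t1 have "1 - k2\<^sup>2 * t\<^sup>2 > 0" by simp
      moreover have "k1\<^sup>2 * t\<^sup>2 \<le> k2\<^sup>2 * t\<^sup>2" using kk by (intro mult_right_mono) auto
      ultimately have rs: "0 < r" "r \<le> s" "s \<le> 1" "r\<^sup>2 = 1 - k2\<^sup>2 * t\<^sup>2" "s\<^sup>2 = 1 - k1\<^sup>2 * t\<^sup>2"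
        by (auto simp: r_def s_def)
      have q: "0 < q" "q \<le> 1" using t1 by (auto simp: q_def)
      have "d * t\<^sup>2 = (s - r) * ((s + r) / 2)"
        using rs(4,5) by (simp add: d_def power2_eq_square field_simps)
      also have "\<dots> \<le> (s - r) * 1"
        using rs by (intro mult_left_mono) auto
      also have "\<dots> \<le> (s - r) * (1 / (q * (r * s)))"
      proof (rule mult_left_mono)
        have "q * (r * s) \<le> 1 * (1 * 1)" using rs q by (intro mult_mono) auto
        then show "1 \<le> 1 / (q * (r * s))" using rs q by (simp add: field_simps)
      qed (use rs in auto)
      also have "\<dots> = 1 / (q * r) - 1 / (q * s)"
        using rs q by (simp add: field_simps)
      also have "\<dots> = ?f k2 t - ?f k1 t"
        by (simp add: q_def r_def s_def real_sqrt_mult)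
      finally show ?thesis using False by simp
    qed simp
  qed
  with d show ?thesis by simp
qed

lemma elliptic_K_nonneg: 
  assumes "0 \<le> k" "k < 1"
  shows "elliptic_K k \<ge> 0"
proof (cases "elliptic_K k = 0")
  case False
  show ?thesis
    unfolding elliptic_K_def
  proof (rule integral_nonneg[OF elliptic_K_integrable[OF False]])
  fix t :: real assume t: "t \<in> {0..1}"
  have "t\<^sup>2 \<le> 1" "k\<^sup>2 \<le> 1" using t assms by (auto simp: power_le_one)
  then have "k\<^sup>2 * t\<^sup>2 \<le> 1 * 1" by (intro mult_mono) auto
  with \<open>t\<^sup>2 \<le> 1\<close> show "0 \<le> 1 / sqrt ((1 - t\<^sup>2) * (1 - k\<^sup>2 * t\<^sup>2))" by simp
  qed
qed simp

text \<open>As \<open>k\<close> grows, the numerator falls and the denominator rises. A nonzero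
  quotient also says that numerator and denominator are nonzero, since division by zero gives 0, and
  this supplies the integrability that strict monotonicity relies on.\<close>

lemma modulus_unique:
  assumes "0 < k1" "k1 < 1" "0 < k2" "k2 < 1"
    and eq: "elliptic_K (sqrt (1 - k1\<^sup>2)) / elliptic_K k1 = elliptic_K (sqrt (1 - k2\<^sup>2)) / elliptic_K k2"
    and nz: "elliptic_K (sqrt (1 - k1\<^sup>2)) / elliptic_K k1 \<noteq> 0"
  shows "k1 = k2"
proof -
  have *: "elliptic_K (sqrt (1 - b\<^sup>2)) / elliptic_K b < elliptic_K (sqrt (1 - a\<^sup>2)) / elliptic_K a"
    if "0 < a" "a < b" "b < 1" "elliptic_K (sqrt (1 - a\<^sup>2)) / elliptic_K a \<noteq> 0"
       "elliptic_K (sqrt (1 - b\<^sup>2)) / elliptic_K b \<noteq> 0" for a b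
  proof -
    have sq: "a\<^sup>2 < b\<^sup>2" "b\<^sup>2 < 1" "0 < a\<^sup>2"
      using that by (auto intro!: power_strict_mono simp: power_less_one_iff)
    have nz: "elliptic_K a \<noteq> 0" "elliptic_K b \<noteq> 0"
       "elliptic_K (sqrt (1 - a\<^sup>2)) \<noteq> 0" "elliptic_K (sqrt (1 - b\<^sup>2)) \<noteq> 0"
      using that by auto
    have "elliptic_K a < elliptic_K b"
      using that nz by (intro elliptic_K_strict_mono) auto
    moreover have "elliptic_K (sqrt (1 - b\<^sup>2)) < elliptic_K (sqrt (1 - a\<^sup>2))"
      using that sq nz by (intro elliptic_K_strict_mono) auto
    moreover have "elliptic_K a > 0" "elliptic_K (sqrt (1 - b\<^sup>2)) > 0"
      using nz elliptic_K_nonneg[of a] elliptic_K_nonneg[of "sqrt (1 - b\<^sup>2)"] that sq by auto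
    ultimately show ?thesis by (intro frac_less) auto
  qed
  show ?thesis
    using *[of k1 k2] *[of k2 k1] assms by (cases k1 k2 rule: linorder_cases) auto
qed

section \<open>The moduli of the period lattice\<close>

lemma has_real_derivative_Re_line:
  assumes "(F has_field_derivative D) (at (of_real t * z + w))"
  shows "((\<lambda>t. Re (F (of_real t * z + w))) has_real_derivative Re (D * z)) (at t)"
proof -
  have "((\<lambda>x. F (x * z + w)) has_field_derivative D * z) (at (of_real t))"
    by (rule DERIV_chain2[where f = F and g = "\<lambda>x. x * z + w", OF assms]) (auto intro!: derivative_eq_intros)
  then have "((\<lambda>t. F (of_real t * z + w)) has_vector_derivative D * z) (at t)"
    by (rule has_vector_derivative_real_field)
  then show ?thesis
    unfolding has_real_derivative_iff_has_vector_derivative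
    by (rule bounded_linear.has_vector_derivative[OF bounded_linear_Re])
qed

context csc_sums
begin

text \<open>On the horizontal line through \<open>\<i> p / 2\<close> the function \<open>N\<close> is real; there \<open>G t = B sn (A t)\<close>.\<close>

definition "half_line t = complex_of_real t + \<i> * of_real p / 2"
definition "G t = Re (N (half_line t))"
definition "G1 t = Re (deriv N (half_line t))"

lemma half_line_not_in_L: "half_line t \<notin> L"
  using p_pos by (intro Im_not_in_L) (auto simp: half_line_def)

lemma N_half_line: "N (half_line t) = of_real (G t)"
proof -
  have "cnj (N (half_line t)) = N (cnj (half_line t) + \<i> * of_real p)"
    by (simp add: cnj_N N_row)
  also have "cnj (half_line t) + \<i> * of_real p = half_line t"
    by (simp add: half_line_def complex_eq_iff)
  finally have "Im (N (half_line t)) = 0" by (simp add: complex_eq_iff)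
  then show ?thesis by (simp add: G_def complex_eq_iff)
qed

lemma deriv_G: "(G has_real_derivative G1 t) (at t)"
  using has_real_derivative_Re_line[of N _ t 1 "\<i> * of_real p / 2"]
    holomorphic_derivI[OF N_holo open_L, of "half_line t"] half_line_not_in_L[of t]
  by (simp add: G_def[abs_def] G1_def half_line_def)

lemma deriv_G1: "(G1 has_real_derivative 2 * G t ^ 3 + Re c * G t) (at t)"
proof -
  have "(G1 has_real_derivative Re (deriv (deriv N) (half_line t))) (at t)"
    using has_real_derivative_Re_line[of "deriv N" _ t 1 "\<i> * of_real p / 2"]
      holomorphic_derivI[OF N'_holo open_L, of "half_line t"] half_line_not_in_L[of t]
    by (simp add: G1_def[abs_def] half_line_def)
  then show ?thesis
    by (simp add: N_ode[OF half_line_not_in_L] N_half_line flip: of_real_power)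
qed

lemma G_0: "G 0 = 0"
proof -
  have "N (half_line 0) = N (- half_line 0 + \<i> * of_real p)"
    by (rule arg_cong[of _ _ N]) (simp add: half_line_def)
  also have "\<dots> = - N (half_line 0)" by (simp only: N_row N_minus)
  finally show ?thesis by (simp add: G_def)
qed

lemma G_reflect: "G (pi - t) = G t"
proof -
  have "N (half_line (pi - t)) = N (- half_line t + of_real pi + \<i> * of_real p)"
    by (rule arg_cong[of _ _ N]) (simp add: half_line_def)
  also have "\<dots> = N (half_line t)" by (simp only: N_row N_pi N_minus minus_minus)
  finally show ?thesis by (simp add: G_def)
qed

lemma G1_half_pi: "G1 (pi / 2) = 0"
proof -
  have "((\<lambda>t. G (pi - t)) has_real_derivative G1 (pi - pi / 2) * (- 1)) (at (pi / 2))"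
    by (rule DERIV_chain2[OF deriv_G]) (auto intro!: derivative_eq_intros)
  then have "(G has_real_derivative - G1 (pi / 2)) (at (pi / 2))"
    by (simp add: G_reflect)
  from DERIV_unique[OF this deriv_G] show ?thesis by simp
qed

text \<open>Every term of the series has positive real part: on the rows the real part of the sine
  is \<open>sin t * cosh y\<close>, and inversion preserves the right half-plane.\<close>

lemma G_pos:
  assumes "0 < t" "t < pi"
  shows "G t > 0"
proof -
  let ?f = "\<lambda>n::int. 1 / sin (half_line t + \<i> * of_real (of_int n * p))"
  have pos: "Re (?f n) > 0" for n :: int
  proof -
    define y where "y = p / 2 + of_int n * p"
    have eq: "half_line t + \<i> * of_real (of_int n * p) = Complex t y"
      by (simp add: half_line_def y_def complex_eq_iff)
    have "Re (sin (Complex t y)) = sin t * cosh y"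
      by (simp add: Re_sin cosh_def exp_minus)
    moreover have "sin t > 0" using assms by (intro sin_gt_zero)
    ultimately have "Re (sin (Complex t y)) > 0" by simp
    then show ?thesis
      unfolding eq by (simp add: Re_divide sum_power2_gt_zero_iff)
  qed
  have "(?f has_sum N (half_line t)) UNIV"
    using csc_sum_has_sum[OF p_pos, of 1 "half_line t"] by (simp add: N_def)
  then have "((\<lambda>n. Re (?f n)) has_sum G t) UNIV"
    unfolding G_def by (rule has_sum_Re)
  from has_sum_strict_mono[OF has_sum_0_simp this less_imp_le[OF pos] UNIV_I pos] show ?thesis .
qed

lemma isCont_G: "isCont G t"
  using deriv_G by (rule DERIV_isCont)

lemma cont_G: "continuous_on X G"
  by (simp add: continuous_at_imp_continuous_on isCont_G)

lemma G_energy_aux: "G1 t ^ 2 - G t ^ 4 - Re c * G t ^ 2 = G1 0 ^ 2"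
proof -
  have "((\<lambda>t. G1 t ^ 2 - G t ^ 4 - Re c * G t ^ 2) has_real_derivative 0) (at t)" for t
    by (rule derivative_eq_intros deriv_G deriv_G1 refl)+ (simp add: algebra_simps power3_eq_cube)
  then have "G1 t ^ 2 - G t ^ 4 - Re c * G t ^ 2 = G1 0 ^ 2 - G 0 ^ 4 - Re c * G 0 ^ 2"
    using DERIV_isconst_all by blast
  then show ?thesis by (simp add: G_0)
qed

text \<open>\<open>B\<close> is the value at the critical point \<open>pi / 2\<close>, so
  \<open>B^2\<close> is a root of the quadratic in \<open>G^2\<close> to which the energy integral
  equates the squared derivative. \<open>A\<close> is defined so that \<open>A^2\<close> is the
  other root: the product of the roots is the constant term, \<open>(G1 0)^2\<close>.\<close>

definition "B = G (pi / 2)"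
definition "A = \<bar>G1 0\<bar> / B"

lemma B_pos: "B > 0"
  unfolding B_def by (rule G_pos) (auto simp: field_simps)

lemma A_nonneg: "A \<ge> 0"
  using B_pos by (simp add: A_def)

lemma AB_sq: "A\<^sup>2 * B\<^sup>2 = (G1 0)\<^sup>2"
  using B_pos by (simp add: A_def power_divide)

text \<open>Vieta's formula for the sum of the roots, obtained by evaluating the energy integral at
  the critical point.\<close>

lemma Re_c: "Re c = - (A\<^sup>2 + B\<^sup>2)"
proof -
  have "- (B ^ 4) - Re c * B\<^sup>2 = A\<^sup>2 * B\<^sup>2"
    using G_energy_aux[of "pi / 2"] by (simp add: G1_half_pi B_def[symmetric] AB_sq)
  then have "B\<^sup>2 * Re c = B\<^sup>2 * (- (A\<^sup>2 + B\<^sup>2))"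
    by (simp add: algebra_simps power2_eq_square eval_nat_numeral)
  then show ?thesis using B_pos by simp
qed

lemma G_energy: "(G1 t)\<^sup>2 = (A\<^sup>2 - (G t)\<^sup>2) * (B\<^sup>2 - (G t)\<^sup>2)"
  using G_energy_aux[of t] unfolding Re_c AB_sq[symmetric]
  by (simp add: algebra_simps power2_eq_square eval_nat_numeral)

lemma G_attains:
  assumes "0 \<le> m" "m \<le> G s" "0 \<le> s"
  obtains t where "0 \<le> t" "t \<le> s" "G t = m"
  using IVT'[of G 0 m s] assms cont_G by (auto simp: G_0)

text \<open>For values strictly between \<open>A\<close> and \<open>B\<close> the energy integral
  would make a square negative. Excluding the midpoint is enough of a barrier, since a continuous
  function that passes from one side to the other must take that value.\<close>

lemma G_not_between:
  assumes "A \<noteq> B"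
  shows "G t \<noteq> (A + B) / 2"
proof
  assume eq: "G t = (A + B) / 2"
  have "(A\<^sup>2 - (G t)\<^sup>2) * (B\<^sup>2 - (G t)\<^sup>2) = - ((A - B)\<^sup>2 * (3 * A + B) * (A + 3 * B) / 16)"
    unfolding eq by (simp add: field_simps power2_eq_square)
  moreover have "(A - B)\<^sup>2 * (3 * A + B) * (A + 3 * B) / 16 > 0"
    using assms A_nonneg B_pos by (intro divide_pos_pos mult_pos_pos) auto
  ultimately have "(G1 t)\<^sup>2 < 0" using G_energy[of t] by simp
  then show False by simp
qed

lemma A_pos: "A > 0"
proof (rule ccontr)
  assume "\<not> A > 0"
  then have A: "A = 0" using A_nonneg by simp
  obtain t where "G t = B / 2"
    using G_attains[of "B / 2" "pi / 2"] B_pos by (auto simp: B_def)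
  with G_not_between[of t] A B_pos show False by simp
qed

text \<open>If \<open>A = B\<close>, then \<open>A - G\<close> would satisfy a linear differential inequality and vanish
  identically, since it vanishes at \<open>\<pi> / 2\<close>.\<close>

lemma B_less_A: "B < A"
proof (rule ccontr)
  assume "\<not> B < A"
  then consider "A < B" | "A = B" by linarith
  then show False
  proof cases
    case 1
    then obtain t where "G t = (A + B) / 2"
      using G_attains[of "(A + B) / 2" "pi / 2"] A_nonneg B_pos by (auto simp: B_def)
    with G_not_between[of t] 1 show False by simp
  next
    case 2
    have "bounded ((\<lambda>t. A + G t) ` {0..pi / 2})"
      by (intro compact_imp_bounded compact_continuous_image continuous_intros cont_G compact_Icc)
    then obtain M where "\<forall>x\<in>(\<lambda>t. A + G t) ` {0..pi / 2}. \<bar>x\<bar> \<le> M"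
      unfolding bounded_real by blast
    then have M: "\<bar>A + G t\<bar> \<le> M" if "0 \<le> t" "t \<le> pi / 2" for t
      using that by simp
    have G1: "\<bar>G1 t\<bar> = \<bar>A - G t\<bar> * \<bar>A + G t\<bar>" for t
    proof -
      have "(G1 t)\<^sup>2 = ((A - G t) * (A + G t))\<^sup>2"
        using G_energy[of t] 2 by (simp add: power2_eq_square algebra_simps)
      then have "\<bar>G1 t\<bar> = \<bar>(A - G t) * (A + G t)\<bar>" by (metis real_sqrt_abs)
      then show ?thesis by (simp add: abs_mult)
    qed
    \<comment> \<open>A Gronwall weight: the exponential outweighs the growth rate of
      \<open>(A - G)^2\<close> in either direction, so the product cannot fall from
      \<open>A^2\<close> at 0 to 0 at \<open>pi / 2\<close>.\<close>
    let ?\<psi> = "\<lambda>t. (A - G t)\<^sup>2 * exp (2 * M * t)"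
    have "?\<psi> 0 \<le> ?\<psi> (pi / 2)"
    proof (rule DERIV_nonneg_imp_nondecreasing[of 0 "pi / 2" ?\<psi>])
      fix t assume t: "0 \<le> t" "t \<le> pi / 2"
      have "(?\<psi> has_real_derivative
          (2 * (A - G t) * (- G1 t) + 2 * M * (A - G t)\<^sup>2) * exp (2 * M * t)) (at t)"
        by (rule derivative_eq_intros deriv_G refl)+ (simp add: algebra_simps)
      moreover have "2 * (A - G t) * G1 t \<le> 2 * M * (A - G t)\<^sup>2"
      proof -
        have "(A - G t) * G1 t \<le> \<bar>A - G t\<bar> * \<bar>G1 t\<bar>"
          by (metis abs_ge_self abs_mult)
        also have "\<dots> = \<bar>A - G t\<bar>\<^sup>2 * \<bar>A + G t\<bar>"
          by (simp only: G1 power2_eq_square mult.assoc)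
        also have "\<dots> \<le> \<bar>A - G t\<bar>\<^sup>2 * M"
          using M[OF t] by (intro mult_left_mono) auto
        finally show ?thesis by (simp add: algebra_simps)
      qed
      then have "0 \<le> (2 * (A - G t) * (- G1 t) + 2 * M * (A - G t)\<^sup>2) * exp (2 * M * t)"
        by (intro mult_nonneg_nonneg) simp_all
      ultimately show "\<exists>y. (?\<psi> has_real_derivative y) (at t) \<and> 0 \<le> y"
        by blast
    qed simp
    moreover have "G (pi / 2) = A" using 2 by (simp add: B_def)
    ultimately have "A = 0" by (simp add: G_0)
    with A_pos show False by simp
  qed
qed

text \<open>By the energy integral a value above \<open>B\<close> would have to be at least
  \<open>A\<close>; starting from 0, \<open>G\<close> would then cross the forbidden
  midpoint.\<close>

lemma G_le_B:
  assumes "0 \<le> t" "t \<le> pi"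
  shows "G t \<le> B"
proof (rule ccontr)
  assume "\<not> G t \<le> B"
  then have gt: "B < G t" by simp
  have "G t \<ge> A"
  proof (rule ccontr)
    assume "\<not> G t \<ge> A"
    then have "(G t)\<^sup>2 < A\<^sup>2" "B\<^sup>2 < (G t)\<^sup>2"
      using gt B_pos by (auto intro!: power_strict_mono)
    then have "(A\<^sup>2 - (G t)\<^sup>2) * (B\<^sup>2 - (G t)\<^sup>2) < 0" by (intro mult_pos_neg) auto
    then show False using G_energy[of t] by (metis not_less zero_le_power2)
  qed
  then obtain s where "G s = (A + B) / 2"
    using G_attains[of "(A + B) / 2" t] assms B_less_A B_pos A_pos by auto
  with G_not_between[of s] B_less_A show False by simp
qed

text \<open>\<open>G\<close> is strictly concave on \<open>(0, \<pi>)\<close>, so its derivative stays positive up to the critical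
  point \<open>\<pi> / 2\<close>.\<close>

lemma G1_pos:
  assumes "0 \<le> t" "t < pi / 2"
  shows "G1 t > 0"
proof -
  have "G1 (pi / 2) < G1 t"
  proof (rule DERIV_neg_imp_decreasing_open[OF assms(2)])
    fix s assume s: "t < s" "s < pi / 2"
    then have G: "0 < G s" "G s \<le> B" "G s < A"
      using G_pos[of s] G_le_B[of s] assms B_less_A by auto
    have "(G s)\<^sup>2 \<le> B\<^sup>2" "(G s)\<^sup>2 < A\<^sup>2"
      using G by (auto intro!: power_mono power_strict_mono)
    then have "2 * (G s)\<^sup>2 - (A\<^sup>2 + B\<^sup>2) < 0" by linarith
    then have "G s * (2 * (G s)\<^sup>2 - (A\<^sup>2 + B\<^sup>2)) < 0"
      using G by (intro mult_pos_neg)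
    then have "2 * G s ^ 3 + Re c * G s < 0"
      by (simp add: Re_c algebra_simps power2_eq_square power3_eq_cube)
    then show "\<exists>y. (G1 has_real_derivative y) (at s) \<and> y < 0"
      using deriv_G1 by blast
  next
    show "continuous_on {t..pi / 2} G1"
      using deriv_G1 DERIV_isCont continuous_at_imp_continuous_on by blast
  qed
  then show ?thesis by (simp add: G1_half_pi)
qed

definition "k = B / A"
definition "w t = G t / B"

lemma k_bounds: "0 < k" "k < 1" "k\<^sup>2 < 1"
  using A_pos B_pos B_less_A by (auto simp: k_def power_less_one_iff)

lemma w_bounds:
  assumes "0 < t" "t < pi / 2"
  shows "0 \<le> w t \<and> w t < 1"
proof -
  have "G t \<noteq> B"
  proof
    assume "G t = B"
    then have "(G1 t)\<^sup>2 = 0" using G_energy[of t] by simp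
    then show False using G1_pos[of t] assms by simp
  qed
  then show ?thesis
    using G_pos[of t] G_le_B[of t] assms B_pos by (simp add: w_def less_le)
qed

lemma w_deriv:
  assumes "0 < t" "t < pi / 2"
  shows "(w has_real_derivative A * sqrt ((1 - (w t)\<^sup>2) * (1 - k\<^sup>2 * (w t)\<^sup>2))) (at t)"
proof -
  have "(G1 t / B)\<^sup>2 = A\<^sup>2 * ((1 - (w t)\<^sup>2) * (1 - k\<^sup>2 * (w t)\<^sup>2))"
    using A_pos B_pos unfolding power_divide G_energy w_def k_def
    by (simp add: field_simps power2_eq_square)
  then have "\<bar>G1 t / B\<bar> = sqrt (A\<^sup>2 * ((1 - (w t)\<^sup>2) * (1 - k\<^sup>2 * (w t)\<^sup>2)))"
    by (metis real_sqrt_abs)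
  moreover have "\<bar>G1 t / B\<bar> = G1 t / B"
    using G1_pos[of t] assms B_pos by simp
  ultimately have "G1 t / B = A * sqrt ((1 - (w t)\<^sup>2) * (1 - k\<^sup>2 * (w t)\<^sup>2))"
    using A_pos by (simp add: real_sqrt_mult)
  moreover have "(w has_real_derivative G1 t / B) (at t)"
    unfolding w_def[abs_def] by (rule DERIV_cdivide[OF deriv_G])
  ultimately show ?thesis by simp
qed

lemma w_cont: "continuous_on X w"
  unfolding w_def[abs_def] using B_pos by (intro continuous_intros cont_G) auto

lemma w_ends: "w 0 = 0" "w (pi / 2) = 1"
  using B_pos by (auto simp: w_def G_0 B_def)

lemma elliptic_K_k: "elliptic_K k = A * (pi / 2)"
  by (rule elliptic_K_substitution[OF _ A_pos k_bounds(3) w_cont w_ends w_bounds w_deriv]) auto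

end

text \<open>For \<open>v = s / sqrt (s^2 + B^2)\<close> and a function \<open>s\<close> with
  derivative \<open>sqrt ((s^2 + A^2) * (s^2 + B^2))\<close>, the left side is the derivative of
  \<open>v\<close>. The right side is the Legendre form whose squared modulus is complementary to
  \<open>B^2 / A^2\<close>.\<close>

lemma quotient_deriv_identity:
  fixes s A B :: real
  assumes "B > 0" "A > 0"
  shows "B\<^sup>2 * sqrt ((s\<^sup>2 + A\<^sup>2) * (s\<^sup>2 + B\<^sup>2)) / (sqrt (s\<^sup>2 + B\<^sup>2)) ^ 3 =
     A * sqrt ((1 - (s / sqrt (s\<^sup>2 + B\<^sup>2))\<^sup>2) * (1 - (1 - B\<^sup>2 / A\<^sup>2) * (s / sqrt (s\<^sup>2 + B\<^sup>2))\<^sup>2))"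
proof -
  define a where "a = sqrt (s\<^sup>2 + A\<^sup>2)"
  define b where "b = sqrt (s\<^sup>2 + B\<^sup>2)"
  have pos: "s\<^sup>2 + A\<^sup>2 > 0" "s\<^sup>2 + B\<^sup>2 > 0" using assms by (auto intro: add_nonneg_pos)
  then have ab: "a > 0" "b > 0" "a\<^sup>2 = s\<^sup>2 + A\<^sup>2" "b\<^sup>2 = s\<^sup>2 + B\<^sup>2"
    by (simp_all add: a_def b_def)
  have "1 - (s / b)\<^sup>2 = (b\<^sup>2 - s\<^sup>2) / b\<^sup>2"
    using ab(2) by (simp add: power_divide diff_divide_distrib)
  then have 1: "1 - (s / b)\<^sup>2 = (B / b)\<^sup>2"
    by (simp add: ab(4) power_divide)
  have 2: "1 - (1 - B\<^sup>2 / A\<^sup>2) * (s / b)\<^sup>2 = (B * a / (A * b))\<^sup>2"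
  proof -
    have "A\<^sup>2 * b\<^sup>2 - (A\<^sup>2 - B\<^sup>2) * s\<^sup>2 = B\<^sup>2 * a\<^sup>2"
      unfolding ab by (simp add: algebra_simps)
    then have "(A\<^sup>2 * b\<^sup>2 - (A\<^sup>2 - B\<^sup>2) * s\<^sup>2) / (A\<^sup>2 * b\<^sup>2) = B\<^sup>2 * a\<^sup>2 / (A\<^sup>2 * b\<^sup>2)"
      by simp
    moreover have "(A\<^sup>2 * b\<^sup>2 - (A\<^sup>2 - B\<^sup>2) * s\<^sup>2) / (A\<^sup>2 * b\<^sup>2) = 1 - (1 - B\<^sup>2 / A\<^sup>2) * (s / b)\<^sup>2"
      using ab(2) assms by (simp add: field_simps power_divide)
    ultimately show ?thesis by (simp add: power_divide power_mult_distrib)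
  qed
  have "sqrt ((s\<^sup>2 + A\<^sup>2) * (s\<^sup>2 + B\<^sup>2)) = a * b"
    by (simp add: a_def b_def real_sqrt_mult)
  moreover have "sqrt ((B / b)\<^sup>2 * (B * a / (A * b))\<^sup>2) = B / b * (B * a / (A * b))"
    using ab(1,2) assms by (simp add: real_sqrt_mult)
  ultimately show ?thesis
    unfolding b_def[symmetric] 1 2 using ab(1,2) assms
    by (simp add: field_simps power2_eq_square power3_eq_cube)
qed

section \<open>The complementary modulus from the imaginary axis\<close>

context csc_sums
begin

text \<open>Oddness and conjugation symmetry make \<open>N\<close> purely imaginary on this axis. By
  Jacobi's imaginary transformation \<open>S y\<close> is \<open>A cs (A y)\<close> for the
  complementary modulus; the sign makes it positive near 0.\<close>

definition "S y = - Im (N (\<i> * of_real y))"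
definition "S1 y = - Re (deriv N (\<i> * of_real y))"

lemma imag_not_in_L: "0 < y \<Longrightarrow> y < p \<Longrightarrow> \<i> * of_real y \<notin> L"
  by (intro Im_not_in_L) auto

lemma N_imag: "N (\<i> * of_real y) = - (\<i> * of_real (S y))"
proof -
  have "cnj (N (\<i> * of_real y)) = - N (\<i> * of_real y)"
    using N_minus[of "\<i> * of_real y"] by (simp add: cnj_N)
  then have "Re (N (\<i> * of_real y)) = 0" by (simp add: complex_eq_iff)
  then show ?thesis by (simp add: S_def complex_eq_iff)
qed

lemma deriv_S:
  assumes "0 < y" "y < p"
  shows "(S has_real_derivative S1 y) (at y)"
proof -
  have "((\<lambda>u. \<i> * N u) has_field_derivative \<i> * deriv N (\<i> * of_real y)) (at (of_real y * \<i> + 0))"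
    using holomorphic_derivI[OF N_holo open_L, of "\<i> * of_real y"] imag_not_in_L[OF assms]
    by (intro DERIV_cmult) (simp add: mult.commute)
  from has_real_derivative_Re_line[OF this] show ?thesis
    by (simp add: S_def[abs_def] S1_def mult.commute)
qed

lemma deriv_S1:
  assumes "0 < y" "y < p"
  shows "(S1 has_real_derivative 2 * S y ^ 3 - Re c * S y) (at y)"
proof -
  have "((\<lambda>u. - deriv N u) has_field_derivative - deriv (deriv N) (\<i> * of_real y)) (at (of_real y * \<i> + 0))"
    using holomorphic_derivI[OF N'_holo open_L, of "\<i> * of_real y"] imag_not_in_L[OF assms]
    by (intro DERIV_minus) (simp add: mult.commute)
  from has_real_derivative_Re_line[OF this]
  have "(S1 has_real_derivative Im (deriv (deriv N) (\<i> * of_real y))) (at y)"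
    by (simp add: S1_def[abs_def] mult.commute)
  moreover have "deriv (deriv N) (\<i> * of_real y) = \<i> * of_real (2 * S y ^ 3) - \<i> * of_real (S y) * c"
    unfolding N_ode[OF imag_not_in_L[OF assms]] N_imag by (simp add: power3_eq_cube)
  ultimately show ?thesis by (simp add: mult.commute)
qed

lemma S_half: "S (p / 2) = 0" and S1_half: "S1 (p / 2) = - G1 0"
proof -
  have eq: "\<i> * of_real (p / 2) = half_line 0" by (simp add: half_line_def)
  show "S (p / 2) = 0" unfolding S_def eq N_half_line by simp
  show "S1 (p / 2) = - G1 0" unfolding S1_def eq G1_def ..
qed

text \<open>The constant of integration is read off at \<open>\<i> * p / 2\<close>, where the
  imaginary axis meets the horizontal line: there \<open>S\<close> vanishes and \<open>S1\<close> is
  \<open>- G1 0\<close>. So the same \<open>A\<close> and \<open>B\<close> occur, with the signs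
  inside the factors reversed.\<close>

lemma S_energy:
  assumes "0 < y" "y < p"
  shows "(S1 y)\<^sup>2 = ((S y)\<^sup>2 + A\<^sup>2) * ((S y)\<^sup>2 + B\<^sup>2)"
proof -
  let ?f = "\<lambda>y. S1 y ^ 2 - S y ^ 4 + Re c * S y ^ 2"
  have "?f y = ?f (p / 2)"
  proof (rule DERIV_isconst3[of 0 p y "p / 2" ?f])
    fix y assume "y \<in> {0<..<p}"
    then have y: "0 < y" "y < p" by auto
    show "(?f has_real_derivative 0) (at y)"
      by (rule derivative_eq_intros deriv_S[OF y] deriv_S1[OF y] refl)+
         (simp add: algebra_simps power3_eq_cube)
  qed (use assms p_pos in auto)
  then show ?thesis
    unfolding S_half S1_half Re_c using AB_sq
    by (simp add: algebra_simps power2_eq_square eval_nat_numeral)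
qed

text \<open>On the imaginary axis \<open>1 / sin\<close> becomes \<open>- \<i> / sinh\<close>, so
  \<open>S\<close> is \<open>1 / sinh\<close> plus a term that tends to 0.\<close>

lemma S_at_top: "filterlim S at_top (at_right 0)"
proof -
  have eq: "S y = 1 / sinh y + Re (\<i> * r (\<i> * of_real y))" for y
  proof -
    have "sin (\<i> * of_real y) = \<i> * of_real (sinh y)"
      by (simp add: complex_eq_iff Re_sin Im_sin sinh_field_def)
    then have "N (\<i> * of_real y) = - \<i> * of_real (1 / sinh y) + r (\<i> * of_real y)"
      by (simp add: r_def divide_inverse)
    then show ?thesis by (simp add: S_def)
  qed
  have "((\<lambda>y. Re (\<i> * r (\<i> * of_real y))) \<longlongrightarrow> Re (\<i> * 0)) (at_right 0)"
  proof (intro tendsto_intros)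
    have "isCont r (\<i> * of_real 0)" using r_tendsto by (simp add: isCont_def r_0)
    moreover have "isCont (\<lambda>y. \<i> * complex_of_real y) 0" by (intro continuous_intros)
    ultimately have "isCont (\<lambda>y. r (\<i> * of_real y)) 0" by (rule isCont_o2[rotated])
    then show "((\<lambda>y. r (\<i> * of_real y)) \<longlongrightarrow> 0) (at_right 0)"
      by (simp add: isCont_def r_0 filterlim_at_split)
  qed
  moreover have "filterlim (\<lambda>y::real. 1 / sinh y) at_top (at_right 0)"
    by real_asymp
  ultimately show ?thesis
    using filterlim_tendsto_add_at_top[of "\<lambda>y. Re (\<i> * r (\<i> * of_real y))"]
    by (subst ext[of S, OF eq]) (simp add: add.commute)
qed

text \<open>The energy has no zero, so \<open>S1\<close> cannot change sign. Because
  \<open>S\<close> falls from infinity at 0 to 0 at \<open>p / 2\<close>, the mean value theorem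
  provides one point where \<open>S1\<close> is negative.\<close>

lemma S1_neg:
  assumes "0 < y" "y < p"
  shows "S1 y < 0"
proof -
  have nz: "S1 z \<noteq> 0" if "0 < z" "z < p" for z
  proof
    assume "S1 z = 0"
    then have "((S z)\<^sup>2 + A\<^sup>2) * ((S z)\<^sup>2 + B\<^sup>2) = 0" using S_energy[OF that] by simp
    then show False using A_pos B_pos by (simp add: sum_power2_eq_zero_iff)
  qed
  have "\<forall>\<^sub>F y in at_right 0. S y \<ge> 1 \<and> y \<in> {0<..<p / 2}"
    using S_at_top p_pos
    by (intro eventually_conj eventually_at_right_real) (auto simp: filterlim_at_top)
  then obtain x where x: "S x \<ge> 1" "0 < x" "x < p / 2"
    using eventually_happens[of _ "at_right (0::real)"] by auto
  obtain z where z: "x < z" "z < p / 2" "S (p / 2) - S x = (p / 2 - x) * S1 z"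
    using MVT2[of x "p / 2" S S1] x deriv_S p_pos by auto
  have "S1 z < 0"
  proof (rule ccontr)
    assume "\<not> S1 z < 0"
    then have "(p / 2 - x) * S1 z \<ge> 0" using x by (intro mult_nonneg_nonneg) auto
    with z(3) x(1) show False by (simp add: S_half)
  qed
  have z': "0 < z" "z < p" using z x p_pos by auto
  have cont: "isCont S1 t" if "0 < t" "t < p" for t
    using deriv_S1[OF that] by (rule DERIV_isCont)
  show ?thesis
  proof (rule ccontr)
    assume "\<not> S1 y < 0"
    then have "S1 z \<le> 0" "0 \<le> S1 y" using \<open>S1 z < 0\<close> by auto
    then have "\<exists>t. min y z \<le> t \<and> t \<le> max y z \<and> S1 t = 0"
    proof (cases "z \<le> y")
      case True
      then have "\<exists>t\<ge>z. t \<le> y \<and> S1 t = 0"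
        using \<open>S1 z \<le> 0\<close> \<open>0 \<le> S1 y\<close> assms z' cont by (intro IVT) auto
      then show ?thesis using True by (auto simp: min_def max_def)
    next
      case False
      then have "\<exists>t\<ge>y. t \<le> z \<and> S1 t = 0"
        using \<open>S1 z \<le> 0\<close> \<open>0 \<le> S1 y\<close> assms z' cont by (intro IVT2) auto
      then show ?thesis using False by (auto simp: min_def max_def)
    qed
    then show False using nz assms z' by (metis less_le_trans min_less_iff_conj le_less_trans max_less_iff_conj)
  qed
qed

lemma S_pos:
  assumes "0 < y" "y < p / 2"
  shows "S y > 0"
proof -
  have "S (p / 2) < S y"
  proof (rule DERIV_neg_imp_decreasing[OF assms(2)])
    fix x assume "y \<le> x" "x \<le> p / 2"
    then have "0 < x" "x < p" using assms p_pos by auto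
    then show "\<exists>d. (S has_real_derivative d) (at x) \<and> d < 0"
      using deriv_S S1_neg by blast
  qed
  then show ?thesis by (simp add: S_half)
qed

definition "k' = sqrt (1 - k\<^sup>2)"

lemma k'_sq: "k'\<^sup>2 = 1 - B\<^sup>2 / A\<^sup>2" "k'\<^sup>2 < 1"
proof -
  have eq: "k'\<^sup>2 = 1 - k\<^sup>2"
    using k_bounds(3) by (simp add: k'_def)
  then show "k'\<^sup>2 = 1 - B\<^sup>2 / A\<^sup>2" by (simp add: k_def power_divide)
  show "k'\<^sup>2 < 1" unfolding eq using k_bounds(1) by simp
qed

text \<open>The substitution turning \<open>ds / sqrt ((s\<^sup>2 + A\<^sup>2) (s\<^sup>2 + B\<^sup>2))\<close> on \<open>(0, \<infinity>)\<close> into the integrand of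
  \<open>K(k')\<close> on \<open>(0, 1)\<close>; the value 1 at \<open>p / 2\<close> accounts for the pole of \<open>N\<close> at 0.\<close>

definition "v t = (if t = p / 2 then 1 else S (p / 2 - t) / sqrt ((S (p / 2 - t))\<^sup>2 + B\<^sup>2))"

lemma v_deriv:
  assumes t: "0 < t" "t < p / 2"
  shows "(v has_real_derivative A * sqrt ((1 - (v t)\<^sup>2) * (1 - k'\<^sup>2 * (v t)\<^sup>2))) (at t)"
proof -
  define y where "y = p / 2 - t"
  have y: "0 < y" "y < p" using t p_pos by (auto simp: y_def)
  have pos: "(S y)\<^sup>2 + B\<^sup>2 > 0" using B_pos by (auto intro: add_nonneg_pos)
  let ?b = "sqrt ((S y)\<^sup>2 + B\<^sup>2)"
  have b: "?b > 0" "?b\<^sup>2 = (S y)\<^sup>2 + B\<^sup>2" using pos by simp_all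
  have "((\<lambda>y. S y / sqrt ((S y)\<^sup>2 + B\<^sup>2)) has_real_derivative S1 y * B\<^sup>2 / ?b ^ 3) (at y)"
  proof -
    have "((\<lambda>y. (S y)\<^sup>2 + B\<^sup>2) has_real_derivative 2 * S y * S1 y) (at y)"
      by (auto intro!: derivative_eq_intros deriv_S[OF y])
    from DERIV_divide[OF deriv_S[OF y] DERIV_chain2[OF DERIV_real_sqrt[OF pos] this]] b(1)
    have "((\<lambda>y. S y / sqrt ((S y)\<^sup>2 + B\<^sup>2)) has_real_derivative
        (S1 y * ?b - S y * ((2 * S y * S1 y) * (inverse ?b / 2))) / (?b * ?b)) (at y)"
      using B_pos by (simp add: mult.commute)
    also have "(S1 y * ?b - S y * ((2 * S y * S1 y) * (inverse ?b / 2))) = S1 y * (?b\<^sup>2 - (S y)\<^sup>2) / ?b"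
    proof -
      have "x * c - s * ((2 * s * x) * (inverse c / 2)) = x * (c\<^sup>2 - s\<^sup>2) / c" if "c > 0" for x s c :: real
        using that by (simp add: field_simps power2_eq_square)
      from this[OF b(1)] show ?thesis .
    qed
    also have "S1 y * (?b\<^sup>2 - (S y)\<^sup>2) / ?b / (?b * ?b) = S1 y * B\<^sup>2 / ?b ^ 3"
      unfolding b(2) by (simp add: power3_eq_cube mult.assoc)
    finally show ?thesis .
  qed
  then have "((\<lambda>t. S (p / 2 - t) / sqrt ((S (p / 2 - t))\<^sup>2 + B\<^sup>2)) has_real_derivative
      S1 y * B\<^sup>2 / ?b ^ 3 * (- 1)) (at t)"
    unfolding y_def by (rule DERIV_chain2[where g = "\<lambda>t. p / 2 - t"]) (auto intro!: derivative_eq_intros)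
  then have "(v has_real_derivative S1 y * B\<^sup>2 / ?b ^ 3 * (- 1)) (at t)"
    by (rule has_field_derivative_transform_within_open[of _ _ _ "{..<p / 2}"])
       (use t in \<open>auto simp: v_def\<close>)
  moreover have "- S1 y = sqrt (((S y)\<^sup>2 + A\<^sup>2) * ((S y)\<^sup>2 + B\<^sup>2))"
    using S1_neg[OF y] by (simp flip: S_energy[OF y])
  then have "S1 y * B\<^sup>2 / ?b ^ 3 * (- 1) = B\<^sup>2 * sqrt (((S y)\<^sup>2 + A\<^sup>2) * ((S y)\<^sup>2 + B\<^sup>2)) / ?b ^ 3"
    by (simp flip: \<open>- S1 y = _\<close>)
  moreover have "v t = S y / ?b"
    using t by (simp add: v_def y_def)
  ultimately show ?thesis
    unfolding k'_sq(1) quotient_deriv_identity[OF B_pos A_pos] by simp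
qed

lemma v_bounds:
  assumes "0 < t" "t < p / 2"
  shows "0 \<le> v t \<and> v t < 1"
proof -
  have S: "S (p / 2 - t) > 0" using assms by (intro S_pos) auto
  then have "S (p / 2 - t) = sqrt ((S (p / 2 - t))\<^sup>2)" by simp
  also have "\<dots> < sqrt ((S (p / 2 - t))\<^sup>2 + B\<^sup>2)" using B_pos by (intro real_sqrt_less_mono) simp
  finally have "S (p / 2 - t) / sqrt ((S (p / 2 - t))\<^sup>2 + B\<^sup>2) < 1"
    using B_pos by (subst divide_less_eq_1_pos) (auto intro: add_nonneg_pos)
  then show ?thesis using S assms by (simp add: v_def)
qed

lemma v_cont: "continuous_on {0..p / 2} v"
  unfolding continuous_on_eq_continuous_within
proof
    fix t assume t: "t \<in> {0..p / 2}"
    show "continuous (at t within {0..p / 2}) v"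
    proof (cases "t = p / 2")
      case False
      define y where "y = p / 2 - t"
      have y: "0 < y" "y < p" using t False p_pos by (auto simp: y_def)
      have "isCont S y" using deriv_S[OF y] by (rule DERIV_isCont)
      then have "isCont (\<lambda>t. S (p / 2 - t)) t"
        unfolding y_def by (intro isCont_o2[where f = "\<lambda>t. p / 2 - t" and g = S] continuous_intros)
      moreover have "sqrt ((S (p / 2 - t))\<^sup>2 + B\<^sup>2) \<noteq> 0"
        using B_pos by (simp add: sum_power2_eq_zero_iff)
      ultimately have "isCont (\<lambda>t. S (p / 2 - t) / sqrt ((S (p / 2 - t))\<^sup>2 + B\<^sup>2)) t"
        by (intro continuous_intros)
      moreover have "\<forall>\<^sub>F x in nhds t. v x = S (p / 2 - x) / sqrt ((S (p / 2 - x))\<^sup>2 + B\<^sup>2)"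
        using t1_space_nhds[OF False] by (rule eventually_mono) (simp add: v_def)
      ultimately have "isCont v t" by (simp add: isCont_cong)
      then show ?thesis by (rule continuous_at_imp_continuous_at_within)
    next
      case True
      have "((\<lambda>s :: real. s / sqrt (s\<^sup>2 + B\<^sup>2)) \<longlongrightarrow> 1) at_top"
        using B_pos by real_asymp
      from filterlim_compose[OF this S_at_top]
      have "((\<lambda>y. S y / sqrt ((S y)\<^sup>2 + B\<^sup>2)) \<longlongrightarrow> 1) (at_right 0)" .
      moreover have "filterlim (\<lambda>t. p / 2 - t) (at_right 0) (at_left (p / 2))"
        by real_asymp
      ultimately have "((\<lambda>t. S (p / 2 - t) / sqrt ((S (p / 2 - t))\<^sup>2 + B\<^sup>2)) \<longlongrightarrow> 1) (at_left (p / 2))"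
        by (rule filterlim_compose)
      then have "(v \<longlongrightarrow> 1) (at_left (p / 2))"
        by (rule Lim_transform_eventually) (auto simp: v_def eventually_at_filter)
      then show ?thesis
        using p_pos by (simp add: True continuous_within v_def[of "p / 2"] at_within_Icc_at_left)
    qed
qed

lemma elliptic_K_k': "elliptic_K k' = A * (p / 2)"
proof (rule elliptic_K_substitution[OF _ A_pos k'_sq(2) v_cont _ _ v_bounds v_deriv])
  show "v 0 = 0" "v (p / 2) = 1" using p_pos by (simp_all add: v_def S_half)
qed (use p_pos in auto)

end

section \<open>Evaluation of the Eisenstein sums\<close>

text \<open>The antiderivative is minus the cotangent, which has period \<open>pi\<close> and no
  pole on a line off the real axis.\<close>

lemma csc_squared_integral:
  assumes "Im z \<noteq> 0"
  shows "((\<lambda>t. 1 / sin (of_real t + z) ^ 2) has_integral 0) {0..pi}"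
proof -
  have nz: "sin (of_real t + z) \<noteq> 0" for t :: real
  proof
    assume "sin (of_real t + z) = 0"
    then have "Im (of_real t + z) = 0" unfolding sin_eq_0 by (metis Im_complex_of_real)
    with assms show False by simp
  qed
  let ?F = "\<lambda>t. - (cos (of_real t + z) / sin (of_real t + z))"
  have "((\<lambda>t. 1 / sin (of_real t + z) ^ 2) has_integral (?F pi - ?F 0)) {0..pi}"
  proof (rule fundamental_theorem_of_calculus)
    fix t :: real
    have "((\<lambda>u. - (cos (u + z) / sin (u + z))) has_field_derivative 1 / sin (of_real t + z) ^ 2) (at (of_real t))"
    proof -
      have "((\<lambda>u. - (cos (u + z) / sin (u + z))) has_field_derivative
          (cos (of_real t + z) * cos (of_real t + z) + sin (of_real t + z) * sin (of_real t + z)) /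
          (sin (of_real t + z) * sin (of_real t + z))) (at (of_real t))"
        using nz[of t] by (auto intro!: derivative_eq_intros simp: diff_divide_distrib add_divide_distrib
            simp del: sin_cos_squared_add3)
      then show ?thesis by (simp add: power2_eq_square)
    qed
    then show "(?F has_vector_derivative 1 / sin (of_real t + z) ^ 2) (at t within {0..pi})"
      using has_vector_derivative_real_field has_vector_derivative_at_within by blast
  qed simp
  moreover have "?F pi = ?F 0"
    by (simp add: sin_add cos_add)
  ultimately show ?thesis by simp
qed

context csc_sums
begin

lemma P_half_line: "P (half_line t) = of_real ((G t)\<^sup>2) - a"
  using N_sq_minus_P[OF half_line_not_in_L, of t] by (simp add: N_half_line algebra_simps)

text \<open>Each row integrates to 0. The finitely many near rows are integrated separately, and
  uniform convergence of the far rows permits interchanging the sum and the integral.\<close>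

lemma P_half_line_integral: "((\<lambda>t. P (half_line t)) has_integral 0) {0..pi}"
proof -
  let ?f = "\<lambda>n t. 1 / sin (half_line t + \<i> * of_real (of_int n * p)) ^ 2"
  have row: "(?f n has_integral 0) {0..pi}" for n :: int
  proof -
    \<comment> \<open>The rows lie at odd multiples of \<open>p / 2\<close>, so none of them is on
      the real axis.\<close>
    have "Im (\<i> * of_real p / 2 + \<i> * of_real (of_int n * p)) = p * (of_int (2 * n + 1) / 2)"
      by (simp add: algebra_simps)
    moreover have "of_int (2 * n + 1) \<noteq> (0 :: real)"
      unfolding of_int_eq_0_iff by presburger
    ultimately have "Im (\<i> * of_real p / 2 + \<i> * of_real (of_int n * p)) \<noteq> 0"
      using p_pos by (simp only: mult_eq_0_iff divide_eq_0_iff) simp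
    from csc_squared_integral[OF this] show ?thesis
      by (simp add: half_line_def add.assoc)
  qed
  have sum0: "((\<lambda>t. \<Sum>n\<in>X. ?f n t) has_integral 0) {0..pi}" for X
  proof (cases "finite X")
    case True
    then have "((\<lambda>t. \<Sum>n\<in>X. ?f n t) has_integral (\<Sum>n\<in>X. 0)) {0..pi}"
      by (intro has_integral_sum row)
    then show ?thesis by simp
  qed simp
  have cont: "continuous_on {0..pi} (\<lambda>t. \<Sum>n\<in>X. ?f n t)" for X
  proof (intro continuous_intros ballI)
    show "continuous_on {0..pi} half_line"
      unfolding half_line_def[abs_def] by (intro continuous_intros) auto
    fix n :: int and t :: real
    have "sin (half_line t + \<i> * of_real (of_int n * p)) \<noteq> 0"
      using half_line_not_in_L[of t] unfolding csc_lattice_def by blast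
    then show "sin (half_line t + \<i> * of_real (of_int n * p)) ^ 2 \<noteq> 0" by simp
  qed
  let ?far = "\<lambda>t. \<Sum>\<^sub>\<infinity>n\<in>- near_rows p (p / 2). ?f n t"
  have "uniform_limit {0..pi} (\<lambda>X t. \<Sum>n\<in>X. ?f n t) ?far (finite_subsets_at_top (- near_rows p (p / 2)))"
    by (rule uniform_limit_compose'[OF uniform_limit_far_rows[OF p_pos]])
       (use p_pos in \<open>auto simp: half_line_def\<close>)
  from uniform_limit_integral[OF this cont finite_subsets_at_top_neq_bot] obtain I J where IJ: "\<And>X. ((\<lambda>t. \<Sum>n\<in>X. ?f n t) has_integral I X) {0..pi}"
      "(?far has_integral J) {0..pi}" "(I \<longlongrightarrow> J) (finite_subsets_at_top (- near_rows p (p / 2)))"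
    by blast
  have "I X = 0" for X using IJ(1) sum0 by (rule has_integral_unique)
  then have "I = (\<lambda>_. 0)" by blast
  then have "J = 0"
    using IJ(3) by (simp add: tendsto_const_iff)
  with IJ(2) have "((\<lambda>t. (\<Sum>n\<in>near_rows p (p / 2). ?f n t) + ?far t) has_integral (0 + 0)) {0..pi}"
    by (intro has_integral_add sum0) simp
  then show ?thesis
    by (simp add: P_def csc_sum_split[OF p_pos, of 2 _ "p / 2"])
qed

text \<open>Over the whole interval the mean of \<open>G^2\<close> equals that of
  \<open>Re a\<close>, because \<open>P\<close> has mean 0; the reflection at \<open>pi / 2\<close>
  splits the integral into equal halves.\<close>

lemma G_sq_integral: "integral {0..pi / 2} (\<lambda>t. (G t)\<^sup>2) = pi / 2 * Re a"
proof -
  let ?f = "\<lambda>t. (G t)\<^sup>2"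
  have cont: "continuous_on X ?f" for X by (intro continuous_intros cont_G)
  have int: "?f integrable_on {s..t}" for s t by (rule integrable_continuous_real[OF cont])
  have "((\<lambda>t. Re (P (half_line t))) has_integral Re 0) {0..pi}"
    using has_integral_linear[OF P_half_line_integral bounded_linear_Re] by (simp add: o_def)
  then have "((\<lambda>t. ?f t - Re a + Re a) has_integral (0 + (pi - 0) * Re a)) {0..pi}"
    using has_integral_const_real[of "Re a" 0 pi] by (intro has_integral_add) (simp_all add: P_half_line)
  then have total: "integral {0..pi} ?f = pi * Re a"
    by (simp add: integral_unique)
  have "integral {pi / 2..pi} ?f = integral {- pi..- (pi / 2)} (\<lambda>x. ?f (- x))"
    using Henstock_Kurzweil_Integration.integral_reflect_real[of pi "pi / 2" ?f] by simp
  also have "(\<lambda>x. ?f (- x)) = ?f \<circ> (\<lambda>x. x + pi)"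
    using G_reflect by (auto simp: fun_eq_iff add.commute) (metis G_reflect diff_minus_eq_add add.commute)
  also have "integral {- pi..- (pi / 2)} (?f \<circ> (\<lambda>x. x + pi)) = integral {- pi + pi..- (pi / 2) + pi} ?f"
    by (rule integral_shift[OF cont])
  finally have "integral {pi / 2..pi} ?f = integral {0..pi / 2} ?f" by simp
  moreover have "integral {0..pi / 2} ?f + integral {pi / 2..pi} ?f = integral {0..pi} ?f"
    by (rule Henstock_Kurzweil_Integration.integral_combine[OF _ _ int]) auto
  ultimately show ?thesis using total by simp
qed

text \<open>Since \<open>k * w\<close> is \<open>G / A\<close>, the weight
  \<open>1 - k^2 * w^2\<close> of the second kind is \<open>1 - G^2 / A^2\<close>, and the mean of
  \<open>G^2\<close> is known.\<close>

lemma elliptic_E_k: "elliptic_E k = A * (pi / 2) - pi / 2 * Re a / A"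
proof -
  let ?f = "\<lambda>t. (G t)\<^sup>2"
  let ?F = "\<lambda>t. A * t - integral {0..t} ?f / A"
  have cont: "continuous_on {0..pi / 2} ?f" by (intro continuous_intros cont_G)
  have within: "((\<lambda>t. integral {0..t} ?f) has_real_derivative ?f t) (at t within {0..pi / 2})"
    if "t \<in> {0..pi / 2}" for t
    by (rule integral_has_real_derivative[OF cont that])
  have "elliptic_E k = ?F (pi / 2) - ?F 0"
  proof (rule elliptic_E_substitution[OF _ A_pos k_bounds(3) w_cont w_ends w_bounds w_deriv])
    show "continuous_on {0..pi / 2} ?F"
      using DERIV_continuous_on[OF within] A_pos by (intro continuous_intros) auto
    fix t assume t: "0 < t" "t < pi / 2"
    then have "((\<lambda>t. integral {0..t} ?f) has_real_derivative ?f t) (at t)"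
      using within[of t] by (simp add: at_within_Icc_at)
    then have "(?F has_real_derivative A - ?f t / A) (at t)"
      using A_pos by (auto intro!: derivative_eq_intros)
    moreover have "A - ?f t / A = A * (1 - k\<^sup>2 * (w t)\<^sup>2)"
      using A_pos B_pos by (simp add: k_def w_def field_simps power2_eq_square)
    ultimately show "(?F has_real_derivative A * (1 - k\<^sup>2 * (w t)\<^sup>2)) (at t)" by simp
  qed auto
  then show ?thesis by (simp add: G_sq_integral)
qed

lemma a_real: "a = of_real (Re a)"
proof -
  have "cnj (P (half_line 0)) = P (cnj (half_line 0) + \<i> * of_real p)"
    by (simp add: P_row P_def cnj_csc_sum csc_sum_shift_row)
  also have "cnj (half_line 0) + \<i> * of_real p = half_line 0"
    by (simp add: half_line_def complex_eq_iff)
  finally have "Im (P (half_line 0)) = 0" by (simp add: complex_eq_iff)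
  then show ?thesis by (simp add: P_half_line complex_eq_iff)
qed

lemma A_eq: "A = 2 * elliptic_K k / pi" and B_eq: "B = k * A"
  and Re_a_eq: "Re a = A\<^sup>2 - 2 * A * elliptic_E k / pi"
proof -
  show "A = 2 * elliptic_K k / pi" by (simp add: elliptic_K_k)
  show "B = k * A" using A_pos by (simp add: k_def)
  show "Re a = A\<^sup>2 - 2 * A * elliptic_E k / pi"
    using A_pos unfolding elliptic_E_k by (simp add: field_simps power2_eq_square)
qed

text \<open>Eliminating \<open>deriv r 0\<close> from the definitions of \<open>a\<close> and
  \<open>c\<close> gives \<open>rP 0\<close>. The summand \<open>1 / 3\<close>, coming from the row
  \<open>n = 0\<close>, cancels the constant left by \<open>- (1 + c) / 3\<close>.\<close>

lemma csc_sum_at_0: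
  "of_real pi ^ 2 * (1 / 3 + csc_sum 2 p 0) =
     of_real (4 / 3 * elliptic_K k * (3 * elliptic_E k + (k\<^sup>2 - 2) * elliptic_K k))"
proof -
  have "csc_sum 2 p 0 = rP 0" by (simp add: rP_def P_def)
  also have "\<dots> = - (1 + c) / 3 - a" by (simp add: a_def c_def)
  finally have eq: "csc_sum 2 p 0 = - (1 + c) / 3 - a" .
  \<comment> \<open>Only the real part of \<open>c\<close> has been computed, so the sum is first
    shown to be real.\<close>
  have "cnj (csc_sum 2 p 0) = csc_sum 2 p 0" by (simp add: cnj_csc_sum)
  then have "csc_sum 2 p 0 = of_real (Re (csc_sum 2 p 0))" by (simp add: complex_eq_iff)
  also have "Re (csc_sum 2 p 0) = (A\<^sup>2 + B\<^sup>2 - 1) / 3 - Re a"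
    unfolding eq by (simp add: Re_c)
  finally have "of_real pi ^ 2 * (1 / 3 + csc_sum 2 p 0) = of_real (pi\<^sup>2 * (1 / 3 + ((A\<^sup>2 + B\<^sup>2 - 1) / 3 - Re a)))"
    by simp
  also have "pi\<^sup>2 * (1 / 3 + ((A\<^sup>2 + B\<^sup>2 - 1) / 3 - Re a)) =
      4 / 3 * elliptic_K k * (3 * elliptic_E k + (k\<^sup>2 - 2) * elliptic_K k)"
    unfolding Re_a_eq B_eq A_eq by (simp add: field_simps power2_eq_square)
  finally show ?thesis .
qed

lemma csc_sum_at_half:
  "of_real pi ^ 2 * csc_sum 2 p (half_line (pi / 2)) =
     of_real (4 * elliptic_K k * (elliptic_E k + (k\<^sup>2 - 1) * elliptic_K k))"
proof -
  have "csc_sum 2 p (half_line (pi / 2)) = of_real (B\<^sup>2) - a"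
    using P_half_line[of "pi / 2"] by (simp add: P_def B_def)
  also have "\<dots> = of_real (B\<^sup>2 - Re a)" by (subst a_real) simp
  finally have "of_real pi ^ 2 * csc_sum 2 p (half_line (pi / 2)) = of_real (pi\<^sup>2 * (B\<^sup>2 - Re a))"
    by simp
  also have "pi\<^sup>2 * (B\<^sup>2 - Re a) = 4 * elliptic_K k * (elliptic_E k + (k\<^sup>2 - 1) * elliptic_K k)"
    unfolding Re_a_eq B_eq A_eq by (simp add: field_simps power2_eq_square)
  finally show ?thesis .
qed

end

text \<open>Converts an unconditional sum over the integers into the symmetric limit of the
  Eisenstein definition.\<close>

lemma filterlim_symmetric_int: "filterlim (\<lambda>M. {- int M..int M}) (finite_subsets_at_top UNIV) sequentially"
  unfolding filterlim_finite_subsets_at_top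
proof safe
  fix X :: "int set" assume X: "finite X"
  define K where "K = nat (Max (insert 0 (abs ` X)))"
  have "\<bar>x\<bar> \<le> int K" if "x \<in> X" for x
    using X that Max_ge[of "insert 0 (abs ` X)" "\<bar>x\<bar>"] by (simp add: K_def)
  then have "X \<subseteq> {- int M..int M}" if "M \<ge> K" for M
    using that by (force simp: abs_le_iff)
  then show "\<forall>\<^sub>F M in sequentially. finite {- int M..int M} \<and> X \<subseteq> {- int M..int M} \<and> {- int M..int M} \<subseteq> UNIV"
    by (auto simp: eventually_sequentially)
qed

text \<open>The row \<open>n = 0\<close> contributes \<open>pi^2 / 3\<close>, recorded as
  \<open>1 / 3\<close>; its cosecant term is 0 by convention, so \<open>s\<close> does not count it
  a second time.\<close>

lemma eisenstein_csc:
  assumes \<tau>: "Im \<tau> \<noteq> 0" and sum: "((\<lambda>n::int. 1 / sin (of_real pi * (of_int n * \<tau>)) ^ 2) has_sum s) UNIV"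
  shows "eisenstein_summable (S2_term \<tau>)" "S2 \<tau> = of_real (Im \<tau>) * (of_real pi ^ 2 * (1 / 3 + s))"
proof -
  let ?f = "\<lambda>n::int. 1 / sin (of_real pi * (of_int n * \<tau>)) ^ 2"
  have row: "row_sum (S2_term \<tau>) n \<longlonglongrightarrow> of_real pi ^ 2 * ((if n = 0 then 1 / 3 else 0) + ?f n)" for n
  proof (cases "n = 0")
    case True
    then show ?thesis
      using row_sum_zero by (simp add: row_sum_def[abs_def] S2_term_def cong: if_cong)
  next
    case False
    then have "Im (of_int n * \<tau>) \<noteq> 0" using \<tau> by simp
    from row_sum_nonreal[OF this] False show ?thesis
      by (simp add: row_sum_def[abs_def] S2_term_def)
  qed
  then have lim: "lim (row_sum (S2_term \<tau>) n) = of_real pi ^ 2 * ((if n = 0 then 1 / 3 else 0) + ?f n)" for n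
    by (rule limI)
  have partial: "eisenstein_partial (S2_term \<tau>) M = of_real pi ^ 2 * (1 / 3 + sum ?f {- int M..int M})" for M
    unfolding eisenstein_partial_def lim by (simp add: sum.distrib flip: sum_distrib_left)
  have "(\<lambda>M. sum ?f {- int M..int M}) \<longlonglongrightarrow> s"
    using sum unfolding has_sum_def by (rule filterlim_compose[OF _ filterlim_symmetric_int])
  then have "eisenstein_partial (S2_term \<tau>) \<longlonglongrightarrow> of_real pi ^ 2 * (1 / 3 + s)"
    unfolding partial[abs_def] by (intro tendsto_intros)
  then show "eisenstein_summable (S2_term \<tau>)" "S2 \<tau> = of_real (Im \<tau>) * (of_real pi ^ 2 * (1 / 3 + s))"
    using row unfolding eisenstein_summable_def S2_def eisenstein_sum_def
    by (auto simp: convergent_def limI)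
qed

lemma sin_squared_plus_int_pi:
  fixes z :: complex
  shows "sin (z + of_int m * of_real pi) ^ 2 = sin z ^ 2"
  by (rule periodic_of_int[where f = "\<lambda>z. sin z ^ 2"]) (simp add: sin_add)

lemma has_sum_csc_imaginary:
  assumes "x \<noteq> 0"
  shows "((\<lambda>n::int. 1 / sin (of_real pi * (of_int n * (\<i> * of_real x))) ^ 2) has_sum csc_sum 2 (pi * \<bar>x\<bar>) 0) UNIV"
proof -
  have "sin (of_real pi * (of_int n * (\<i> * of_real x))) ^ 2 =
        sin (0 + \<i> * of_real (of_int n * (pi * \<bar>x\<bar>))) ^ 2" for n :: int
    by (cases "x \<ge> 0") (simp_all add: algebra_simps)
  then show ?thesis
    using csc_sum_has_sum[of "pi * \<bar>x\<bar>" 2 0] assms by simp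
qed

text \<open>For even \<open>n\<close> the point is a multiple of \<open>\<i> * x\<close> up to an
  integer, which the period \<open>pi\<close> of the squared sine absorbs. Odd \<open>n\<close> give
  the same rows translated by half of each period.\<close>

lemma has_sum_csc_half:
  assumes "x \<noteq> 0" and s: "s \<in> {1, -1 :: complex}"
  shows "((\<lambda>n::int. 1 / sin (of_real pi * (of_int n * ((s + \<i> * of_real x) / 2))) ^ 2) has_sum
           (csc_sum 2 (pi * \<bar>x\<bar>) 0 +
            csc_sum 2 (pi * \<bar>x\<bar>) (of_real (pi / 2) + \<i> * of_real (pi * \<bar>x\<bar>) / 2))) UNIV"
proof -
  define p where "p = pi * \<bar>x\<bar>"
  have p: "p > 0" using assms by (simp add: p_def)
  obtain e :: int where e: "s = of_int e" "e = 1 \<or> e = -1" using s by (auto intro: that[of 1] that[of "-1"])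
  let ?f = "\<lambda>n::int. 1 / sin (of_real pi * (of_int n * ((s + \<i> * of_real x) / 2))) ^ 2"
  have even: "?f (2 * j) = 1 / sin (0 + \<i> * of_real (of_int j * p)) ^ 2" for j
  proof -
    have "of_real pi * (of_int (2 * j) * ((s + \<i> * of_real x) / 2)) =
        \<i> * of_real (of_int j * (pi * x)) + of_int (j * e) * of_real pi"
      by (simp add: e(1) algebra_simps)
    then have "?f (2 * j) = 1 / sin (\<i> * of_real (of_int j * (pi * x))) ^ 2"
      by (simp only: sin_squared_plus_int_pi)
    also have "\<dots> = 1 / sin (0 + \<i> * of_real (of_int j * p)) ^ 2"
      by (cases "x \<ge> 0") (simp_all add: p_def)
    finally show ?thesis .
  qed
  have odd: "?f (2 * j + 1) = 1 / sin (of_real (pi / 2) + \<i> * of_real p / 2 + \<i> * of_real (of_int j * p)) ^ 2" for j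
  proof -
    define y where "y = (of_int j + 1 / 2) * (pi * x)"
    have "of_real pi * (of_int (2 * j + 1) * ((s + \<i> * of_real x) / 2)) =
        s * of_real (pi / 2) + \<i> * of_real y + of_int (j * e) * of_real pi"
      by (simp add: e(1) y_def field_simps)
    then have "?f (2 * j + 1) = 1 / sin (s * of_real (pi / 2) + \<i> * of_real y) ^ 2"
      by (simp only: sin_squared_plus_int_pi)
    \<comment> \<open>Passing to the squared cosine of an imaginary argument, an even function of
      \<open>y\<close>, removes the dependence on both the sign \<open>s\<close> and the sign of
      \<open>x\<close>.\<close>
    also have "sin (s * of_real (pi / 2) + \<i> * of_real y) ^ 2 = cos (\<i> * of_real y) ^ 2"
      using s by (auto simp: sin_add sin_of_real cos_of_real simp del: of_real_divide)
    also have "\<dots> = cos (\<i> * of_real \<bar>y\<bar>) ^ 2"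
      by (cases "y \<ge> 0") simp_all
    also have "\<dots> = cos (\<i> * of_real ((of_int j + 1 / 2) * p)) ^ 2"
    proof -
      have "y = (of_int j + 1 / 2) * p \<or> y = - ((of_int j + 1 / 2) * p)"
        by (cases "x \<ge> 0") (simp_all add: y_def p_def)
      then show ?thesis
        by (cases "y \<ge> 0") auto
    qed
    also have "\<dots> = sin (of_real (pi / 2) + \<i> * of_real ((of_int j + 1 / 2) * p)) ^ 2"
      by (simp add: sin_add sin_of_real cos_of_real del: of_real_divide)
    also have "of_real (pi / 2) + \<i> * of_real ((of_int j + 1 / 2) * p) =
         of_real (pi / 2) + \<i> * of_real p / 2 + \<i> * of_real (of_int j * p)"
      by (simp add: algebra_simps)
    finally show ?thesis .
  qed
  have "(?f has_sum csc_sum 2 p 0) (range (\<lambda>j. 2 * j))"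
    using csc_sum_has_sum[OF p, of 2 0]
    by (subst has_sum_reindex) (simp_all only: inj_on_def o_def even, simp)
  moreover have "(?f has_sum csc_sum 2 p (of_real (pi / 2) + \<i> * of_real p / 2)) (range (\<lambda>j. 2 * j + 1))"
    using csc_sum_has_sum[OF p, of 2 "of_real (pi / 2) + \<i> * of_real p / 2"]
    by (subst has_sum_reindex) (simp_all only: inj_on_def o_def odd, simp)
  moreover have "range (\<lambda>j::int. 2 * j) \<inter> range (\<lambda>j. 2 * j + 1) = {}"
    by (auto, presburger)
  ultimately have "(?f has_sum (csc_sum 2 p 0 + csc_sum 2 p (of_real (pi / 2) + \<i> * of_real p / 2)))
      (range (\<lambda>j. 2 * j) \<union> range (\<lambda>j. 2 * j + 1))"
    by (rule has_sum_Un_disjoint)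
  also have "range (\<lambda>j::int. 2 * j) \<union> range (\<lambda>j. 2 * j + 1) = UNIV"
    by (auto simp: image_iff) presburger
  finally show ?thesis by (simp only: p_def)
qed

theorem theorem2:
  fixes x k k' :: real
  assumes "x \<noteq> 0"
    and "0 < k" and "k < 1"
    and "k' = sqrt (1 - k\<^sup>2)"
    and "\<bar>x\<bar> = elliptic_K k' / elliptic_K k"
  shows "eisenstein_summable (S2_term (\<i> * of_real x)) \<and>
         S2 (\<i> * of_real x) =
           of_real (4 / 3 * sgn x * elliptic_K k' *
                    (3 * elliptic_E k + (k\<^sup>2 - 2) * elliptic_K k)) \<and>
         (\<forall>s \<in> {1, -1 :: complex}.
           eisenstein_summable (S2_term ((s + \<i> * of_real x) / 2)) \<and>
           S2 ((s + \<i> * of_real x) / 2) =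
             of_real (2 * sgn x * elliptic_K k' *
                      (2 * elliptic_E k + (4 * k\<^sup>2 - 5) / 3 * elliptic_K k)))"
proof -
  define p where "p = pi * \<bar>x\<bar>"
  interpret cs: csc_sums p
    using assms(1) by unfold_locales (simp add: p_def)
  have quot: "elliptic_K (sqrt (1 - cs.k\<^sup>2)) / elliptic_K cs.k = \<bar>x\<bar>"
    unfolding cs.k'_def[symmetric] cs.elliptic_K_k cs.elliptic_K_k'
    using cs.A_pos by (simp add: p_def)
  have k: "cs.k = k"
  proof (rule modulus_unique[OF cs.k_bounds(1,2) assms(2,3)])
    show "elliptic_K (sqrt (1 - cs.k\<^sup>2)) / elliptic_K cs.k = elliptic_K (sqrt (1 - k\<^sup>2)) / elliptic_K k"
      unfolding quot assms(4)[symmetric] by (rule assms(5))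
    show "elliptic_K (sqrt (1 - cs.k\<^sup>2)) / elliptic_K cs.k \<noteq> 0"
      unfolding quot using assms(1) by simp
  qed
  have K: "elliptic_K k > 0"
    using mult_pos_pos[OF cs.A_pos pi_half_gt_zero] unfolding k[symmetric] cs.elliptic_K_k .
  \<comment> \<open>The evaluated sums carry a factor \<open>x * K(k)\<close>; multiplying this
    relation by \<open>sgn x\<close> trades it for \<open>sgn x * K(k')\<close>.\<close>
  have "\<bar>x\<bar> * elliptic_K k = elliptic_K k'" using assms(5) K by simp
  then have "sgn x * elliptic_K k' = (sgn x * \<bar>x\<bar>) * elliptic_K k" by (simp only: mult.assoc)
  then have x: "x * elliptic_K k = sgn x * elliptic_K k'" by (simp only: mult_sgn_abs)
  note sum0 = cs.csc_sum_at_0[unfolded k] and half = cs.csc_sum_at_half[unfolded k]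
  have hl: "cs.half_line (pi / 2) = of_real (pi / 2) + \<i> * of_real p / 2"
    by (simp add: cs.half_line_def)
  have "eisenstein_summable (S2_term (\<i> * of_real x)) \<and>
         S2 (\<i> * of_real x) =
           of_real (4 / 3 * sgn x * elliptic_K k' *
                    (3 * elliptic_E k + (k\<^sup>2 - 2) * elliptic_K k))"
  proof
    have Im: "Im (\<i> * of_real x) \<noteq> 0" using assms(1) by simp
    note E = eisenstein_csc[OF Im has_sum_csc_imaginary[OF assms(1)], folded p_def]
    show "eisenstein_summable (S2_term (\<i> * of_real x))" by (rule E(1))
    have "S2 (\<i> * of_real x) = of_real x *
        of_real (4 / 3 * elliptic_K k * (3 * elliptic_E k + (k\<^sup>2 - 2) * elliptic_K k))"
      unfolding E(2) sum0 by simp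
    also have "\<dots> = of_real (4 / 3 * (x * elliptic_K k) * (3 * elliptic_E k + (k\<^sup>2 - 2) * elliptic_K k))"
      unfolding of_real_mult[symmetric] by (rule arg_cong[of _ _ of_real]) (simp only: mult_ac)
    finally show "S2 (\<i> * of_real x) =
           of_real (4 / 3 * sgn x * elliptic_K k' * (3 * elliptic_E k + (k\<^sup>2 - 2) * elliptic_K k))"
      unfolding x by (simp only: mult.assoc)
  qed
  moreover have "eisenstein_summable (S2_term ((s + \<i> * of_real x) / 2)) \<and>
           S2 ((s + \<i> * of_real x) / 2) =
             of_real (2 * sgn x * elliptic_K k' *
                      (2 * elliptic_E k + (4 * k\<^sup>2 - 5) / 3 * elliptic_K k))"
    if s: "s \<in> {1, -1 :: complex}" for s
  proof
    have Im_eq: "Im ((s + \<i> * of_real x) / 2) = x / 2" using s by auto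
    then have Im: "Im ((s + \<i> * of_real x) / 2) \<noteq> 0" using assms(1) by simp
    note E = eisenstein_csc[OF Im has_sum_csc_half[OF assms(1) s], folded p_def]
    show "eisenstein_summable (S2_term ((s + \<i> * of_real x) / 2))" by (rule E(1))
    have "of_real pi ^ 2 * (1 / 3 + (csc_sum 2 p 0 + csc_sum 2 p (cs.half_line (pi / 2)))) =
        of_real (4 / 3 * elliptic_K k * (3 * elliptic_E k + (k\<^sup>2 - 2) * elliptic_K k) +
          4 * elliptic_K k * (elliptic_E k + (k\<^sup>2 - 1) * elliptic_K k))"
      unfolding of_real_add sum0[symmetric] half[symmetric] by (simp add: algebra_simps)
    then have "S2 ((s + \<i> * of_real x) / 2) = of_real (x / 2) *
        of_real (4 / 3 * elliptic_K k * (3 * elliptic_E k + (k\<^sup>2 - 2) * elliptic_K k) +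
          4 * elliptic_K k * (elliptic_E k + (k\<^sup>2 - 1) * elliptic_K k))"
      unfolding E(2) Im_eq hl by simp
    \<comment> \<open>The two brackets add up to \<open>8 * E + (16 * k^2 - 20) / 3 * K\<close>,
      four times the bracket on the right; the imaginary part \<open>x / 2\<close> leaves the factor
      2.\<close>
    also have "\<dots> = of_real (2 * (x * elliptic_K k) * (2 * elliptic_E k + (4 * k\<^sup>2 - 5) / 3 * elliptic_K k))"
      unfolding of_real_mult[symmetric] by (rule arg_cong[of _ _ of_real]) (simp add: field_simps)
    finally show "S2 ((s + \<i> * of_real x) / 2) =
             of_real (2 * sgn x * elliptic_K k' * (2 * elliptic_E k + (4 * k\<^sup>2 - 5) / 3 * elliptic_K k))"
      unfolding x by (simp only: mult.assoc)
  qed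
  ultimately show ?thesis by blast
qed

end
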